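(* Let $n$ be a prime number, let $p_1,p_2,p_3,p_4\in\mathbb{Z}^{+}$, let $P_2^4=(p_1,p_2,p_3,-p_4)$ be an oriented pretzel link, and let $\mathbb{Z}_n$ be the dihedral quandle. Put $h=p_1p_2p_3-p_1p_2p_4-p_1p_3p_4-p_2p_3p_4$. Then, with all congruences modulo $n$, $$|\mathrm{Hom}(\mathcal{Q}(P_2^4),\mathbb{Z}_n)|=\begin{cases} n & \text{if } h\not\equiv 0;\\ n^2 & \text{if } h\equiv 0 \text{ and } p_ip_j\not\equiv 0 \text{ for at least one pair } i\neq j,\ i,j\in\{1,2,3,4\};\\ n^3 & \text{if exactly one of } p_1,p_2,p_3,p_4 \text{ is coprime with } n;\\ n^4 & \text{if } p_1\equiv p_2\equiv p_3\equiv p_4\equiv 0.\end{cases}$$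
   Context: A quandle is a set $X$ with a binary operation $\triangleright$ such that $x\triangleright x=x$ for all $x$; for each $y$ the map $x\mapsto x\triangleright y$ is invertible; and $(x\triangleright y)\triangleright z=(x\triangleright z)\triangleright(y\triangleright z)$ for all $x,y,z$. A quandle homomorphism $f$ satisfies $f(x\triangleright y)=f(x)\triangleright f(y)$. The dihedral quandle $\mathbb{Z}_n$ is the set of integers modulo $n$ with $x\triangleright y=2y-x \pmod n$. For an oriented link $K$ with diagram $D$, the fundamental quandle $\mathcal{Q}(K)$ is the quandle generated by the arcs of $D$ with one relation per crossing: if the overcrossing arc is $y$ (pointing up), and $x$ is the undercrossing arc on the right of $y$, then the undercrossing arc on the left of $y$ is $x\triangleright y$. $\mathrm{Hom}(\mathcal{Q}(K),X)$ is the set of quandle homomorphisms (colorings of $K$ by $X$); its cardinality is the coloring number of $K$ (with respect to $X$). Pretzel link: for nonzero integers $p_1,\dots,p_m$, the pretzel link $(p_1,\dots,p_m)$ (an $m$-pretzel link) is formed from $m$ tangles $A_1,\dots,A_m$ placed side by side, where $A_i$ is a vertical column of two strands twisted about each other with $|p_i|$ crossings, all of one fixed handedness if $p_i>0$ ("positive") and all of the opposite handedness if $p_i<0$ ("negative"). The NE endpoint of $A_i$ is joined to the NW endpoint of $A_{i+1}$, the SE endpoint of $A_i$ to the SW endpoint of $A_{i+1}$, and the outer endpoints are closed up by joining the NW (resp. SW) endpoint of $A_1$ to the NE (resp. SE) endpoint of $A_m$. Any orientation of the link may be chosen. *)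

theory Defs
  imports "HOL-Algebra.Congruence" "HOL-Number_Theory.Cong"
begin

section \<open>Quandles\<close>

record 'a quandle = "'a partial_object" +
  quandle_op :: "['a, 'a] \<Rightarrow> 'a" (infixl "\<triangleright>\<index>" 70)

locale quandle =
  fixes X :: "('a, 'b) quandle_scheme" (structure)
  assumes closed: "\<lbrakk>x \<in> carrier X; y \<in> carrier X\<rbrakk> \<Longrightarrow> x \<triangleright> y \<in> carrier X"
    and idem: "x \<in> carrier X \<Longrightarrow> x \<triangleright> x = x"
    and invertible: "y \<in> carrier X \<Longrightarrow> bij_betw (\<lambda>x. x \<triangleright> y) (carrier X) (carrier X)"
    and distrib: "\<lbrakk>x \<in> carrier X; y \<in> carrier X; z \<in> carrier X\<rbrakk>
      \<Longrightarrow> (x \<triangleright> y) \<triangleright> z = (x \<triangleright> z) \<triangleright> (y \<triangleright> z)"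

text \<open>Homomorphisms are taken to be extensional, so that two of them are equal as soon as
  they agree on the carrier and the set of homomorphisms has the right cardinality.\<close>

definition quandle_hom ::
  "('a, 'c) quandle_scheme \<Rightarrow> ('b, 'd) quandle_scheme \<Rightarrow> ('a \<Rightarrow> 'b) set" where
  "quandle_hom X Y = {f \<in> carrier X \<rightarrow>\<^sub>E carrier Y.
     \<forall>x\<in>carrier X. \<forall>y\<in>carrier X. f (x \<triangleright>\<^bsub>X\<^esub> y) = f x \<triangleright>\<^bsub>Y\<^esub> f y}"

definition dihedral_quandle :: "nat \<Rightarrow> int quandle" where
  "dihedral_quandle n = \<lparr>carrier = {0..<int n}, quandle_op = (\<lambda>x y. (2 * y - x) mod int n)\<rparr>"

section \<open>Quandles given by generators and relations\<close>

text \<open>\<open>QInv s t\<close> stands for the preimage of \<open>s\<close> under \<open>x \<mapsto> x \<triangleright> t\<close>.\<close>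

datatype (qgens: 'g) qterm = QGen 'g | QOp "'g qterm" "'g qterm" | QInv "'g qterm" "'g qterm"

definition qterms :: "'g set \<Rightarrow> 'g qterm set" where
  "qterms G = {t. qgens t \<subseteq> G}"

inductive_set qcong :: "'g set \<Rightarrow> ('g qterm \<times> 'g qterm) set \<Rightarrow> ('g qterm \<times> 'g qterm) set"
  for G R where
  rel: "\<lbrakk>(s, t) \<in> R; s \<in> qterms G; t \<in> qterms G\<rbrakk> \<Longrightarrow> (s, t) \<in> qcong G R"
| idem: "s \<in> qterms G \<Longrightarrow> (QOp s s, s) \<in> qcong G R"
| inv_op: "\<lbrakk>s \<in> qterms G; t \<in> qterms G\<rbrakk> \<Longrightarrow> (QInv (QOp s t) t, s) \<in> qcong G R"
| op_inv: "\<lbrakk>s \<in> qterms G; t \<in> qterms G\<rbrakk> \<Longrightarrow> (QOp (QInv s t) t, s) \<in> qcong G R"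
| distrib: "\<lbrakk>s \<in> qterms G; t \<in> qterms G; u \<in> qterms G\<rbrakk>
    \<Longrightarrow> (QOp (QOp s t) u, QOp (QOp s u) (QOp t u)) \<in> qcong G R"
| refl: "s \<in> qterms G \<Longrightarrow> (s, s) \<in> qcong G R"
| sym: "(s, t) \<in> qcong G R \<Longrightarrow> (t, s) \<in> qcong G R"
| trans: "\<lbrakk>(s, t) \<in> qcong G R; (t, u) \<in> qcong G R\<rbrakk> \<Longrightarrow> (s, u) \<in> qcong G R"
| cong_op: "\<lbrakk>(s, s') \<in> qcong G R; (t, t') \<in> qcong G R\<rbrakk>
    \<Longrightarrow> (QOp s t, QOp s' t') \<in> qcong G R"
| cong_inv: "\<lbrakk>(s, s') \<in> qcong G R; (t, t') \<in> qcong G R\<rbrakk>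
    \<Longrightarrow> (QInv s t, QInv s' t') \<in> qcong G R"

definition presented_quandle ::
  "'g set \<Rightarrow> ('g qterm \<times> 'g qterm) set \<Rightarrow> 'g qterm set quandle" where
  "presented_quandle G R =
     \<lparr>carrier = qterms G // qcong G R,
      quandle_op = (\<lambda>A B. \<Union>s\<in>A. \<Union>t\<in>B. qcong G R `` {QOp s t})\<rparr>"

section \<open>Oriented link diagrams\<close>

text \<open>
  A diagram is encoded by its crossings and the way their corners are joined. A dart is one of
  the four strand ends at a crossing. A crossing \<open>(a, b, c, d)\<close> lists its four darts
  counterclockwise, \<open>a\<close> and \<open>c\<close> being the ends of the undercrossing strand and \<open>b\<close> and \<open>d\<close>
  the ends of the overcrossing strand. A pair in \<open>joins\<close> is a segment of the diagram
  between two darts, without crossings in its interior.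
\<close>

record 'd diagram =
  crossings :: "('d \<times> 'd \<times> 'd \<times> 'd) set"
  joins :: "('d \<times> 'd) set"

definition darts :: "'d diagram \<Rightarrow> 'd set" where
  "darts D = (\<Union>(a, b, c, d)\<in>crossings D. {a, b, c, d})"

text \<open>An orientation is given by the predicate telling which darts point into their crossing.\<close>

definition orientation :: "'d diagram \<Rightarrow> ('d \<Rightarrow> bool) \<Rightarrow> bool" where
  "orientation D inc \<longleftrightarrow>
     (\<forall>(a, b, c, d)\<in>crossings D. inc a \<noteq> inc c \<and> inc b \<noteq> inc d) \<and>
     (\<forall>(d, e)\<in>joins D. inc d \<noteq> inc e)"

text \<open>Arcs run along the joins and across crossings on the overcrossing strand; an arc is
  represented by the set of darts lying on it.\<close>

definition arc_steps :: "'d diagram \<Rightarrow> ('d \<times> 'd) set" where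
  "arc_steps D = joins D \<union> {(b, d). \<exists>a c. (a, b, c, d) \<in> crossings D}"

definition arc_of :: "'d diagram \<Rightarrow> 'd \<Rightarrow> 'd set" where
  "arc_of D d = {e. (d, e) \<in> (arc_steps D \<union> (arc_steps D)\<inverse>)\<^sup>*}"

definition arcs :: "'d diagram \<Rightarrow> 'd set set" where
  "arcs D = arc_of D ` darts D"

text \<open>Turn the crossing so that the overcrossing strand points up. If it enters at \<open>b\<close>, then
  \<open>b, c, d, a\<close> are at the bottom, right, top and left; if it enters at \<open>d\<close>, then
  \<open>d, a, b, c\<close> are.\<close>

definition crossing_relation ::
  "'d diagram \<Rightarrow> ('d \<Rightarrow> bool) \<Rightarrow> 'd \<times> 'd \<times> 'd \<times> 'd \<Rightarrow> 'd set qterm \<times> 'd set qterm" where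
  "crossing_relation D inc = (\<lambda>(a, b, c, d).
     let (right, left) = (if inc b then (c, a) else (a, c))
     in (QGen (arc_of D left), QOp (QGen (arc_of D right)) (QGen (arc_of D b))))"

definition fundamental_quandle ::
  "'d diagram \<Rightarrow> ('d \<Rightarrow> bool) \<Rightarrow> 'd set qterm set quandle" where
  "fundamental_quandle D inc =
     presented_quandle (arcs D) (crossing_relation D inc ` crossings D)"

section \<open>Pretzel links\<close>

datatype corner = NW | NE | SW | SE

text \<open>\<open>Rising\<close> is the diagonal from \<open>SW\<close> to \<open>NE\<close>, \<open>Falling\<close> the one from \<open>NW\<close> to \<open>SE\<close>.\<close>

datatype diagonal = Rising | Falling

text \<open>The dart \<open>(i, k, x)\<close> is the corner \<open>x\<close> of the \<open>k\<close>-th crossing from the top in the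
  \<open>i\<close>-th column from the left, both counted from 0.\<close>

type_synonym pretzel_dart = "nat \<times> nat \<times> corner"

fun crossing_over :: "diagonal \<Rightarrow> nat \<Rightarrow> nat \<Rightarrow>
    pretzel_dart \<times> pretzel_dart \<times> pretzel_dart \<times> pretzel_dart" where
  "crossing_over Rising i k = ((i, k, NW), (i, k, SW), (i, k, SE), (i, k, NE))"
| "crossing_over Falling i k = ((i, k, NE), (i, k, NW), (i, k, SW), (i, k, SE))"

fun opposite :: "diagonal \<Rightarrow> diagonal" where
  "opposite Rising = Falling"
| "opposite Falling = Rising"

text \<open>
  Which of the two handednesses counts as positive is a matter of convention: \<open>\<delta>\<close> is the
  diagonal on which the overcrossing strand of a positive column runs. The index
  \<open>Suc i mod length ps\<close> also accounts for the two segments closing up the outer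
  endpoints. All entries of \<open>ps\<close> are meant to be nonzero.
\<close>

definition pretzel_diagram :: "diagonal \<Rightarrow> int list \<Rightarrow> pretzel_dart diagram" where
  "pretzel_diagram \<delta> ps =
     (let m = length ps; q = (\<lambda>i. nat \<bar>ps ! i\<bar>) in
     \<lparr>crossings =
        {crossing_over (if ps ! i > 0 then \<delta> else opposite \<delta>) i k | i k. i < m \<and> k < q i},
      joins =
        {((i, k, SW), (i, Suc k, NW)) | i k. i < m \<and> Suc k < q i} \<union>
        {((i, k, SE), (i, Suc k, NE)) | i k. i < m \<and> Suc k < q i} \<union>
        {((i, 0, NE), (Suc i mod m, 0, NW)) | i. i < m} \<union>
        {((i, q i - 1, SE), (Suc i mod m, q (Suc i mod m) - 1, SW)) | i. i < m}\<rparr>)"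

section \<open>The quandle axioms hold\<close>

lemma qcong_in_terms:
  assumes "(s, t) \<in> qcong G R"
  shows "s \<in> qterms G \<and> t \<in> qterms G"
  using assms by induction (auto simp: qterms_def)

lemma equiv_qcong: "equiv (qterms G) (qcong G R)"
  using qcong_in_terms[of _ _ G R]
  by (intro equivI refl_onI symI transI) (auto intro: qcong.refl qcong.sym qcong.trans)

lemma presented_quandle_op:
  assumes "s \<in> qterms G" "t \<in> qterms G"
  shows "(qcong G R `` {s}) \<triangleright>\<^bsub>presented_quandle G R\<^esub> (qcong G R `` {t}) = qcong G R `` {QOp s t}"
proof -
  have "congruent2 (qcong G R) (qcong G R) (\<lambda>s t. qcong G R `` {QOp s t})"
    unfolding congruent2_def
    by (auto intro!: equiv_class_eq[OF equiv_qcong] qcong.cong_op)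
  then show ?thesis
    unfolding presented_quandle_def
    using UN_equiv_class2[OF equiv_qcong equiv_qcong _ assms] by simp
qed

lemma quandle_presented: "quandle (presented_quandle G R)"
proof -
  let ?Q = "presented_quandle G R" and ?c = "\<lambda>s. qcong G R `` {s}"
  have carr: "carrier ?Q = ?c ` qterms G"
    by (auto simp: presented_quandle_def quotient_def)
  have T: "QOp s t \<in> qterms G" "QInv s t \<in> qterms G" if "s \<in> qterms G" "t \<in> qterms G" for s t
    using that by (auto simp: qterms_def)
  have eq: "?c s = ?c t" if "(s, t) \<in> qcong G R" for s t
    using equiv_class_eq[OF equiv_qcong that] .
  have cancel: "(s, s') \<in> qcong G R"
    if "(QOp s t, QOp s' t) \<in> qcong G R" "s \<in> qterms G" "s' \<in> qterms G" "t \<in> qterms G" for s s' t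
    using qcong.cong_inv[OF that(1) qcong.refl[OF that(4)]] qcong.inv_op[of _ G t R] that
    by (meson qcong.sym qcong.trans)
  show ?thesis
  proof
    show "x \<triangleright>\<^bsub>?Q\<^esub> y \<in> carrier ?Q" if "x \<in> carrier ?Q" "y \<in> carrier ?Q" for x y
      using that by (auto simp: carr presented_quandle_op T)
    show "x \<triangleright>\<^bsub>?Q\<^esub> x = x" if x: "x \<in> carrier ?Q" for x
    proof -
      obtain s where s: "s \<in> qterms G" "x = ?c s" using x by (auto simp: carr)
      then show ?thesis using eq[OF qcong.idem[OF s(1)]] by (simp only: presented_quandle_op)
    qed
    show "bij_betw (\<lambda>x. x \<triangleright>\<^bsub>?Q\<^esub> y) (carrier ?Q) (carrier ?Q)" if y: "y \<in> carrier ?Q" for y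
    proof -
      obtain t where t: "t \<in> qterms G" "y = ?c t" using y by (auto simp: carr)
      have "inj_on (\<lambda>x. x \<triangleright>\<^bsub>?Q\<^esub> y) (carrier ?Q)"
      proof (rule inj_onI)
        fix x x' assume "x \<in> carrier ?Q" "x' \<in> carrier ?Q" and e: "x \<triangleright>\<^bsub>?Q\<^esub> y = x' \<triangleright>\<^bsub>?Q\<^esub> y"
        then obtain s s' where s: "s \<in> qterms G" "x = ?c s" "s' \<in> qterms G" "x' = ?c s'"
          by (auto simp: carr)
        have "?c (QOp s t) = ?c (QOp s' t)"
          using e s t by (simp add: presented_quandle_op)
        then have "(QOp s t, QOp s' t) \<in> qcong G R"
          using eq_equiv_class[OF _ equiv_qcong] T s t by blast
        then show "x = x'" using cancel s t eq by blast
      qed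
      moreover have "x \<in> (\<lambda>x. x \<triangleright>\<^bsub>?Q\<^esub> y) ` carrier ?Q" if x: "x \<in> carrier ?Q" for x
      proof -
        obtain s where s: "s \<in> qterms G" "x = ?c s" using x by (auto simp: carr)
        have "x = ?c (QInv s t) \<triangleright>\<^bsub>?Q\<^esub> y"
          using s t T by (simp add: presented_quandle_op eq[OF qcong.op_inv])
        then show ?thesis using s t T by (auto simp: carr)
      qed
      ultimately show ?thesis
        using t by (auto simp: bij_betw_def carr presented_quandle_op T)
    qed
    show "(x \<triangleright>\<^bsub>?Q\<^esub> y) \<triangleright>\<^bsub>?Q\<^esub> z = (x \<triangleright>\<^bsub>?Q\<^esub> z) \<triangleright>\<^bsub>?Q\<^esub> (y \<triangleright>\<^bsub>?Q\<^esub> z)"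
      if xyz: "x \<in> carrier ?Q" "y \<in> carrier ?Q" "z \<in> carrier ?Q" for x y z
    proof -
      obtain s t u where s: "s \<in> qterms G" "t \<in> qterms G" "u \<in> qterms G"
        and "x = ?c s" "y = ?c t" "z = ?c u"
        using xyz by (auto simp: carr)
      then show ?thesis using eq[OF qcong.distrib[OF s]] T by (simp only: presented_quandle_op)
    qed
  qed
qed

lemma quandle_dihedral:
  assumes "n > 0"
  shows "quandle (dihedral_quandle n)"
proof
  let ?Q = "dihedral_quandle n"
  show "x \<triangleright>\<^bsub>?Q\<^esub> y \<in> carrier ?Q" for x y
    using assms by (simp add: dihedral_quandle_def)
  show "x \<triangleright>\<^bsub>?Q\<^esub> x = x" if "x \<in> carrier ?Q" for x
    using that by (simp add: dihedral_quandle_def)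
  show "bij_betw (\<lambda>x. x \<triangleright>\<^bsub>?Q\<^esub> y) (carrier ?Q) (carrier ?Q)" for y
    by (rule bij_betwI[where g = "\<lambda>x. x \<triangleright>\<^bsub>?Q\<^esub> y"])
      (use assms in \<open>auto simp: dihedral_quandle_def mod_simps\<close>)
  have "(2 * (w mod int n) - v mod int n) mod int n = (2 * w - v) mod int n" for v w
    using mod_diff_eq[of "2 * (w mod int n)" "int n" v] mod_diff_eq[of "2 * w" "int n" v]
    by (simp only: mod_diff_right_eq mod_mult_right_eq mod_simps)
  then show "(x \<triangleright>\<^bsub>?Q\<^esub> y) \<triangleright>\<^bsub>?Q\<^esub> z = (x \<triangleright>\<^bsub>?Q\<^esub> z) \<triangleright>\<^bsub>?Q\<^esub> (y \<triangleright>\<^bsub>?Q\<^esub> z)" for x y z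
    by (simp add: dihedral_quandle_def mod_simps) (simp add: algebra_simps)
qed

end

theory Submission
  imports Defs
begin

text \<open>
  A homomorphism from the fundamental quandle to \<open>\<int>\<^sub>n\<close> is a coloring of the arcs with
  \<open>u + u' = 2 v\<close> at each crossing, where \<open>v\<close> is the color of the overcrossing arc
  (\<open>bij_betw_hom_presented\<close> and \<open>card_hom_fundamental_dihedral\<close>). In a column of a pretzel diagram
  the difference \<open>d\<^sub>i\<close> between the colors of the right and the left strand is the same at every
  height, and each crossing shifts both colors by \<open>\<plusminus> d\<^sub>i\<close> (\<open>crossing_color_iff\<close>); so from top to
  bottom both colors change by \<open>q\<^sub>i d\<^sub>i\<close>, up to a common sign, where \<open>q\<^sub>i\<close> is the signed number of
  crossings. The joins along the top make the \<open>d\<^sub>i\<close> the cyclic differences of the colors \<open>a\<^sub>i\<close> of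
  the NW ends, and the joins along the bottom say that all the \<open>q\<^sub>i d\<^sub>i\<close> are equal
  (\<open>bij_betw_dart_top_colorings\<close>).

  It remains to solve linear equations over a field: the number of colorings is \<open>n\<close>, for \<open>a\<^sub>0\<close>, times
  the number of \<open>d\<close> with \<open>\<Sum> d\<^sub>i = 0\<close> and all \<open>q\<^sub>i d\<^sub>i\<close> equal to some \<open>t\<close>. If \<open>r > 0\<close> of the \<open>q\<^sub>i\<close>
  are divisible by \<open>n\<close>, then \<open>t = 0\<close>, the other gaps vanish, and there are \<open>n\<close> to the power \<open>r - 1\<close>
  solutions \<open>d\<close>. If there is no such \<open>q\<^sub>i\<close>, then \<open>d\<^sub>i = t / q\<^sub>i\<close> with \<open>t \<Sum> 1 / q\<^sub>i = 0\<close>, and there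
  are \<open>n\<close> solutions or only one, according to whether the numerator of \<open>\<Sum> 1 / q\<^sub>i\<close>
  vanishes. All this is done for any number of columns (\<open>card_top_colorings_prime\<close>); for the entries
  \<open>p\<^sub>1, p\<^sub>2, p\<^sub>3, - p\<^sub>4\<close> the numerator is \<open>h\<close>, which also vanishes as soon as two entries do, but
  not if exactly one does.
\<close>

section \<open>Homomorphisms out of a presented quandle\<close>

primrec qeval :: "('b, 'd) quandle_scheme \<Rightarrow> ('g \<Rightarrow> 'b) \<Rightarrow> 'g qterm \<Rightarrow> 'b" where
  "qeval X f (QGen g) = f g"
| "qeval X f (QOp s t) = qeval X f s \<triangleright>\<^bsub>X\<^esub> qeval X f t"
| "qeval X f (QInv s t) =
     inv_into (carrier X) (\<lambda>x. x \<triangleright>\<^bsub>X\<^esub> qeval X f t) (qeval X f s)"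

lemma qterms_simps [simp]:
  "QGen g \<in> qterms G \<longleftrightarrow> g \<in> G"
  "QOp s t \<in> qterms G \<longleftrightarrow> s \<in> qterms G \<and> t \<in> qterms G"
  "QInv s t \<in> qterms G \<longleftrightarrow> s \<in> qterms G \<and> t \<in> qterms G"
  by (auto simp: qterms_def)

lemma carrier_presented:
  "carrier (presented_quandle G R) = (\<lambda>s. qcong G R `` {s}) ` qterms G"
  by (auto simp: presented_quandle_def quotient_def)

lemma qcong_class_eq_iff:
  assumes "s \<in> qterms G" "t \<in> qterms G"
  shows "qcong G R `` {s} = qcong G R `` {t} \<longleftrightarrow> (s, t) \<in> qcong G R"
  using eq_equiv_class_iff[OF equiv_qcong assms] .

context quandle
begin

lemma inv_translation_closed:
  assumes "x \<in> carrier X" "y \<in> carrier X"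
  shows "inv_into (carrier X) (\<lambda>x. x \<triangleright> y) x \<in> carrier X"
  using assms invertible[OF assms(2)] by (simp add: bij_betw_def inv_into_into)

lemma inv_translation_op:
  assumes "x \<in> carrier X" "y \<in> carrier X"
  shows "inv_into (carrier X) (\<lambda>x. x \<triangleright> y) x \<triangleright> y = x"
  using bij_betw_inv_into_right[OF invertible[OF assms(2)] assms(1)] .

lemma op_inv_translation:
  assumes "x \<in> carrier X" "y \<in> carrier X"
  shows "inv_into (carrier X) (\<lambda>x. x \<triangleright> y) (x \<triangleright> y) = x"
  using bij_betw_inv_into_left[OF invertible[OF assms(2)] assms(1)] .

lemma qeval_closed:
  assumes f: "f \<in> G \<rightarrow> carrier X" and t: "t \<in> qterms G"
  shows "qeval X f t \<in> carrier X"
  using t by (induction t) (use f in \<open>auto intro: closed inv_translation_closed\<close>)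

lemma qeval_qcong:
  assumes f: "f \<in> G \<rightarrow> carrier X"
    and R: "\<And>s t. (s, t) \<in> R \<Longrightarrow> qeval X f s = qeval X f t"
    and st: "(s, t) \<in> qcong G R"
  shows "qeval X f s = qeval X f t"
  using st
  by induction
    (use qeval_closed[OF f] in
      \<open>simp_all add: R idem inv_translation_op op_inv_translation distrib\<close>)

lemma hom_presented_op:
  assumes \<phi>: "\<phi> \<in> quandle_hom (presented_quandle G R) X" and st: "s \<in> qterms G" "t \<in> qterms G"
  shows "\<phi> (qcong G R `` {QOp s t}) = \<phi> (qcong G R `` {s}) \<triangleright> \<phi> (qcong G R `` {t})"
proof -
  have "qcong G R `` {s} \<in> carrier (presented_quandle G R)"
    "qcong G R `` {t} \<in> carrier (presented_quandle G R)"
    using st by (auto simp: carrier_presented)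
  then show ?thesis
    using \<phi> presented_quandle_op[OF st, of R] unfolding quandle_hom_def by force
qed

text \<open>In the quandle \<open>X\<close> the formal inverse is forced: from \<open>(s \<triangleright>\<inverse> t) \<triangleright> t = s\<close> in the presented
  quandle, the image of \<open>s \<triangleright>\<inverse> t\<close> is the only preimage of the image of \<open>s\<close> under the translation
  by the image of \<open>t\<close>.\<close>

lemma hom_presented_eq_qeval:
  assumes \<phi>: "\<phi> \<in> quandle_hom (presented_quandle G R) X" and t: "t \<in> qterms G"
  shows "\<phi> (qcong G R `` {t}) = qeval X (\<lambda>g. \<phi> (qcong G R `` {QGen g})) t"
  using t
proof (induction t)
  case (QOp s t)
  then show ?case using hom_presented_op[OF \<phi>] by simp
next
  case (QInv s t)
  have into: "\<phi> (qcong G R `` {u}) \<in> carrier X" if "u \<in> qterms G" for u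
    using \<phi> that by (auto simp: quandle_hom_def carrier_presented)
  have "qcong G R `` {s} = qcong G R `` {QOp (QInv s t) t}"
    using QInv.prems by (subst qcong_class_eq_iff) (auto intro: qcong.sym qcong.op_inv)
  also have "\<phi> \<dots> = \<phi> (qcong G R `` {QInv s t}) \<triangleright> \<phi> (qcong G R `` {t})"
    using hom_presented_op[OF \<phi>] QInv.prems by simp
  finally have "inv_into (carrier X) (\<lambda>x. x \<triangleright> \<phi> (qcong G R `` {t})) (\<phi> (qcong G R `` {s}))
      = \<phi> (qcong G R `` {QInv s t})"
    using into QInv.prems by (simp add: op_inv_translation)
  with QInv show ?case by simp
qed auto

lemma qeval_cong:
  assumes "\<And>g. g \<in> G \<Longrightarrow> f g = f' g" "t \<in> qterms G"
  shows "qeval X f t = qeval X f' t"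
  using assms(2) by (induction t) (use assms(1) in auto)

text \<open>The universal property of a presentation. A homomorphism is determined by its values on
  the generators because it commutes with evaluation of terms, formal inverses included;
  conversely evaluation respects the generated congruence, since the quandle axioms hold in
  the target and the relations hold by assumption.\<close>

lemma bij_betw_hom_presented:
  assumes R: "R \<subseteq> qterms G \<times> qterms G"
  shows "bij_betw (\<lambda>\<phi>. \<lambda>g\<in>G. \<phi> (qcong G R `` {QGen g}))
    (quandle_hom (presented_quandle G R) X)
    {f \<in> G \<rightarrow>\<^sub>E carrier X. \<forall>(s, t)\<in>R. qeval X f s = qeval X f t}"
    (is "bij_betw ?r ?H ?F")
proof -
  let ?Q = "presented_quandle G R" and ?c = "\<lambda>s. qcong G R `` {s}"
  have eval: "\<phi> (?c t) = qeval X (?r \<phi>) t" if "\<phi> \<in> ?H" "t \<in> qterms G" for \<phi> t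
    using hom_presented_eq_qeval[OF that] qeval_cong[OF _ that(2), of "?r \<phi>"] by simp
  have "inj_on ?r ?H"
  proof (rule inj_onI)
    fix \<phi> \<psi> assume h: "\<phi> \<in> ?H" "\<psi> \<in> ?H" and eq: "?r \<phi> = ?r \<psi>"
    have "\<phi> (?c t) = \<psi> (?c t)" if "t \<in> qterms G" for t
      using eval[OF h(1) that] eval[OF h(2) that] eq by metis
    then show "\<phi> = \<psi>"
      using h by (intro PiE_ext[of \<phi> "carrier ?Q" "\<lambda>_. carrier X" \<psi>])
        (auto simp: quandle_hom_def carrier_presented)
  qed
  moreover have "?r \<phi> \<in> ?F" if \<phi>: "\<phi> \<in> ?H" for \<phi>
  proof -
    have "qeval X (?r \<phi>) s = qeval X (?r \<phi>) t" if "(s, t) \<in> R" for s t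
    proof -
      have st: "s \<in> qterms G" "t \<in> qterms G" using that R by auto
      then have "?c s = ?c t"
        using that by (subst qcong_class_eq_iff) (auto intro: qcong.rel)
      then show ?thesis using eval[OF \<phi> st(1)] eval[OF \<phi> st(2)] by simp
    qed
    moreover have "?r \<phi> \<in> G \<rightarrow>\<^sub>E carrier X"
      using \<phi> by (auto simp: quandle_hom_def carrier_presented)
    ultimately show ?thesis by blast
  qed
  moreover have "f \<in> ?r ` ?H" if f: "f \<in> ?F" for f
  proof -
    have fG: "f \<in> G \<rightarrow> carrier X" using f by auto
    \<comment> \<open>Evaluation is constant on congruence classes, so any representative may be chosen.\<close>
    define \<phi> where "\<phi> = (\<lambda>A\<in>carrier ?Q. qeval X f (SOME s. s \<in> A))"
    have \<phi>: "\<phi> (?c s) = qeval X f s" if s: "s \<in> qterms G" for s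
    proof -
      have "s \<in> ?c s" using s by (auto intro: qcong.refl)
      then have "(SOME u. u \<in> ?c s) \<in> ?c s" by (rule someI)
      then have "(s, SOME u. u \<in> ?c s) \<in> qcong G R" by auto
      then have "qeval X f s = qeval X f (SOME u. u \<in> ?c s)"
        by (rule qeval_qcong[OF fG, rotated]) (use f in auto)
      then show ?thesis using s by (auto simp: \<phi>_def carrier_presented)
    qed
    have "\<phi> \<in> carrier ?Q \<rightarrow>\<^sub>E carrier X"
    proof (rule PiE_I)
      show "\<phi> A \<in> carrier X" if "A \<in> carrier ?Q" for A
        using that qeval_closed[OF fG] by (auto simp: carrier_presented \<phi>)
    qed (simp add: \<phi>_def)
    moreover have "\<phi> (A \<triangleright>\<^bsub>?Q\<^esub> B) = \<phi> A \<triangleright> \<phi> B" if "A \<in> carrier ?Q" "B \<in> carrier ?Q" for A B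
      using that by (auto simp: carrier_presented presented_quandle_op \<phi>)
    ultimately have "\<phi> \<in> ?H" by (auto simp: quandle_hom_def)
    moreover have "?r \<phi> = f"
      using f by (auto simp: \<phi> fun_eq_iff PiE_def extensional_def)
    ultimately show ?thesis by blast
  qed
  ultimately show ?thesis by (intro bij_betw_imageI equalityI image_subsetI subsetI)
qed

end

section \<open>Colorings of a diagram\<close>

text \<open>The relation \<open>u' = u \<triangleright> v\<close> of a crossing with undercrossing arcs \<open>u\<close>, \<open>u'\<close> and overcrossing
  arc \<open>v\<close> becomes \<open>u + u' = 2 v\<close> in a dihedral quandle. It is symmetric in \<open>u\<close> and \<open>u'\<close>, so it
  can be written down for the darts of an unoriented diagram. Coloring darts instead of arcs makes
  the coloring of a concrete diagram explicit without having to determine its arcs.\<close>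

definition dart_colorings :: "'d diagram \<Rightarrow> nat \<Rightarrow> ('d \<Rightarrow> int) set" where
  "dart_colorings D n = {c \<in> darts D \<rightarrow>\<^sub>E {0..<int n}.
     (\<forall>(x, y)\<in>arc_steps D. c x = c y) \<and>
     (\<forall>(u, v, u', v')\<in>crossings D. [c u + c u' = 2 * c v] (mod int n))}"

lemma arc_of_refl: "x \<in> arc_of D x"
  by (simp add: arc_of_def)

lemma arc_of_eq:
  assumes "(x, y) \<in> arc_steps D"
  shows "arc_of D x = arc_of D y"
proof -
  let ?S = "arc_steps D \<union> (arc_steps D)\<inverse>"
  have "(x, y) \<in> ?S\<^sup>*" "(y, x) \<in> ?S\<^sup>*" using assms by auto
  then show ?thesis by (auto simp: arc_of_def intro: rtrancl_trans)
qed

lemma constant_on_arc: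
  assumes "\<forall>(x, y)\<in>arc_steps D. c x = c y" and "y \<in> arc_of D x"
  shows "c x = c y"
proof -
  have "(x, y) \<in> (arc_steps D \<union> (arc_steps D)\<inverse>)\<^sup>*" using assms(2) by (simp add: arc_of_def)
  then show ?thesis by induction (use assms(1) in fastforce)+
qed

lemma crossing_darts:
  assumes "(u, v, u', v') \<in> crossings D"
  shows "u \<in> darts D" "v \<in> darts D" "u' \<in> darts D" "v' \<in> darts D"
  using assms by (fastforce simp: darts_def)+

lemma arc_steps_darts:
  assumes "joins D \<subseteq> darts D \<times> darts D" "(x, y) \<in> arc_steps D"
  shows "x \<in> darts D" "y \<in> darts D"
  using assms crossing_darts[of _ _ _ _ D] by (auto simp: arc_steps_def)

lemma dihedral_crossing_relation:
  assumes "x \<in> {0..<int n}" "y \<in> {0..<int n}"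
  shows "y = (2 * z - x) mod int n \<longleftrightarrow> [x + y = 2 * z] (mod int n)"
proof -
  have "y = (2 * z - x) mod int n \<longleftrightarrow> [y = 2 * z - x] (mod int n)"
    using assms by (auto simp: cong_def)
  also have "\<dots> \<longleftrightarrow> [x + y = 2 * z] (mod int n)"
    by (simp add: cong_iff_dvd_diff algebra_simps)
  finally show ?thesis .
qed

text \<open>A function on arcs pulls back along \<open>arc_of D\<close> to a function on darts, and the functions
  obtained in this way are exactly those constant along the steps that generate the arcs.\<close>

lemma card_hom_fundamental_dihedral:
  assumes "n > 0" and joins: "joins D \<subseteq> darts D \<times> darts D"
  shows "card (quandle_hom (fundamental_quandle D inc) (dihedral_quandle n))
    = card (dart_colorings D n)"
proof -
  interpret quandle "dihedral_quandle n" by (rule quandle_dihedral[OF assms(1)])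
  let ?Z = "{0..<int n}"
  let ?R = "crossing_relation D inc ` crossings D"
  let ?F = "{f \<in> arcs D \<rightarrow>\<^sub>E carrier (dihedral_quandle n).
    \<forall>(s, t)\<in>?R. qeval (dihedral_quandle n) f s = qeval (dihedral_quandle n) f t}"
  have "?R \<subseteq> qterms (arcs D) \<times> qterms (arcs D)"
  proof (intro image_subsetI)
    fix w assume "w \<in> crossings D"
    moreover obtain u v u' v' where "w = (u, v, u', v')" by (cases w)
    ultimately show "crossing_relation D inc w \<in> qterms (arcs D) \<times> qterms (arcs D)"
      using crossing_darts[of u v u' v' D] by (simp add: crossing_relation_def arcs_def)
  qed
  from bij_betw_same_card[OF bij_betw_hom_presented[OF this]]
  have "card (quandle_hom (fundamental_quandle D inc) (dihedral_quandle n)) = card ?F"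
    by (simp add: fundamental_quandle_def)
  also have "?F = {f \<in> arcs D \<rightarrow>\<^sub>E ?Z. \<forall>(u, v, u', v')\<in>crossings D.
      [f (arc_of D u) + f (arc_of D u') = 2 * f (arc_of D v)] (mod int n)}"
  proof (rule Collect_cong, rule conj_cong)
    fix f
    assume f: "f \<in> arcs D \<rightarrow>\<^sub>E ?Z"
    then have range: "f (arc_of D x) \<in> ?Z" if "x \<in> darts D" for x
      using that by (auto simp: arcs_def)
    have cr_iff: "(case crossing_relation D inc (u, v, u', v') of (s, t) \<Rightarrow>
        qeval (dihedral_quandle n) f s = qeval (dihedral_quandle n) f t) \<longleftrightarrow>
      [f (arc_of D u) + f (arc_of D u') = 2 * f (arc_of D v)] (mod int n)"
      if cr: "(u, v, u', v') \<in> crossings D" for u v u' v'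
      using dihedral_crossing_relation[OF range range, of u u' "f (arc_of D v)"]
        dihedral_crossing_relation[OF range range, of u' u "f (arc_of D v)"] crossing_darts[OF cr]
      by (simp add: crossing_relation_def dihedral_quandle_def add.commute)
    show "(\<forall>(s, t)\<in>?R. qeval (dihedral_quandle n) f s = qeval (dihedral_quandle n) f t) \<longleftrightarrow>
      (\<forall>(u, v, u', v')\<in>crossings D.
        [f (arc_of D u) + f (arc_of D u') = 2 * f (arc_of D v)] (mod int n))"
      unfolding ball_simps(9)
    proof (rule ball_cong[OF HOL.refl])
      fix w assume w: "w \<in> crossings D"
      obtain u v u' v' where eq: "w = (u, v, u', v')" by (cases w)
      show "(case crossing_relation D inc w of (s, t) \<Rightarrow>
          qeval (dihedral_quandle n) f s = qeval (dihedral_quandle n) f t) \<longleftrightarrow>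
        (case w of (u, v, u', v') \<Rightarrow>
          [f (arc_of D u) + f (arc_of D u') = 2 * f (arc_of D v)] (mod int n))"
        using cr_iff w unfolding eq by simp
    qed
  qed (simp add: dihedral_quandle_def)
  also have "card \<dots> = card (dart_colorings D n)" (is "card ?A = _")
  proof (rule bij_betw_same_card, rule bij_betw_imageI)
    let ?g = "\<lambda>f. \<lambda>x\<in>darts D. f (arc_of D x)"
    show "inj_on ?g ?A"
    proof (rule inj_onI)
      fix f f' assume f: "f \<in> ?A" "f' \<in> ?A" and eq: "?g f = ?g f'"
      have "f (arc_of D x) = f' (arc_of D x)" if "x \<in> darts D" for x
        using fun_cong[OF eq, of x] that by simp
      with f show "f = f'"
        by (intro PiE_ext[of f "arcs D" "\<lambda>_. ?Z" f']) (auto simp: arcs_def)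
    qed
    show "?g ` ?A = dart_colorings D n"
    proof (intro equalityI subsetI)
      fix c assume "c \<in> ?g ` ?A"
      then obtain f where f: "f \<in> ?A" and c: "c = ?g f" by blast
      have "c \<in> darts D \<rightarrow>\<^sub>E ?Z"
        using f by (auto simp: c arcs_def)
      moreover have "c x = c y" if "(x, y) \<in> arc_steps D" for x y
        using arc_of_eq[OF that] arc_steps_darts[OF joins that] by (simp add: c)
      moreover have "[c u + c u' = 2 * c v] (mod int n)"
        if "(u, v, u', v') \<in> crossings D" for u v u' v'
        using f that crossing_darts[OF that] by (auto simp: c)
      ultimately show "c \<in> dart_colorings D n" by (auto simp: dart_colorings_def)
    next
      fix c assume c: "c \<in> dart_colorings D n"
      define f where "f = (\<lambda>A\<in>arcs D. c (inv_into (darts D) (arc_of D) A))"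
      have f: "f (arc_of D x) = c x" if x: "x \<in> darts D" for x
      proof -
        let ?y = "inv_into (darts D) (arc_of D) (arc_of D x)"
        have "arc_of D ?y = arc_of D x" using x by (intro f_inv_into_f) auto
        then have "?y \<in> arc_of D x" using arc_of_refl[of ?y D] by simp
        then have "c x = c ?y"
          using c by (intro constant_on_arc) (auto simp: dart_colorings_def)
        then show ?thesis using x by (simp add: f_def arcs_def)
      qed
      have "f \<in> arcs D \<rightarrow>\<^sub>E ?Z"
      proof (rule PiE_I)
        show "f A \<in> ?Z" if "A \<in> arcs D" for A
          using that c by (force simp: arcs_def f dart_colorings_def)
      qed (simp add: f_def)
      moreover have "[f (arc_of D u) + f (arc_of D u') = 2 * f (arc_of D v)] (mod int n)"
        if "(u, v, u', v') \<in> crossings D" for u v u' v'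
        using c that crossing_darts[OF that] by (auto simp: f dart_colorings_def)
      moreover have "?g f = c"
        using c by (auto simp: f fun_eq_iff dart_colorings_def PiE_def extensional_def)
      ultimately show "c \<in> ?g ` ?A" by (intro image_eqI[of _ _ f]) auto
    qed
  qed
  finally show ?thesis .
qed

section \<open>Colorings of a pretzel diagram\<close>

fun diagonal_sign :: "diagonal \<Rightarrow> int" where
  "diagonal_sign Rising = 1"
| "diagonal_sign Falling = -1"

text \<open>The colors of the two strands of a column form an arithmetic progression modulo \<open>n\<close>, and this
  sign tells whether passing a crossing downwards adds or subtracts their difference.\<close>

definition column_sign :: "diagonal \<Rightarrow> int list \<Rightarrow> nat \<Rightarrow> int" where
  "column_sign \<delta> ps i = diagonal_sign (if ps ! i > 0 then \<delta> else opposite \<delta>)"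

text \<open>The NE end of column \<open>i\<close> has the color of the NW end of column \<open>Suc i mod m\<close>, so the
  difference between the two strands of column \<open>i\<close> is a cyclic difference of NW colors.\<close>

definition gap :: "nat \<Rightarrow> (nat \<Rightarrow> int) \<Rightarrow> nat \<Rightarrow> int" where
  "gap m a i = a (Suc i mod m) - a i"

text \<open>The colors \<open>a i\<close> of the NW ends determine the colors everywhere, and the joins along the
  bottom of the diagram hold exactly if the products below agree in all columns.\<close>

definition top_colorings :: "int list \<Rightarrow> nat \<Rightarrow> (nat \<Rightarrow> int) set" where
  "top_colorings ps n = {a \<in> {..<length ps} \<rightarrow>\<^sub>E {0..<int n}.
     \<exists>t. \<forall>i<length ps. [ps ! i * gap (length ps) a i = t] (mod int n)}"

text \<open>The color, before reduction modulo \<open>n\<close>, that propagates to a dart from the top of its column.\<close>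

definition corner_color :: "diagonal \<Rightarrow> int list \<Rightarrow> (nat \<Rightarrow> int) \<Rightarrow> pretzel_dart \<Rightarrow> int" where
  "corner_color \<delta> ps a = (\<lambda>(i, k, x).
     a (if x \<in> {NE, SE} then Suc i mod length ps else i) +
     column_sign \<delta> ps i * int (if x \<in> {SW, SE} then Suc k else k) * gap (length ps) a i)"

lemma diagonal_sign_opposite: "diagonal_sign (opposite \<delta>) = - diagonal_sign \<delta>"
  by (cases \<delta>) auto

text \<open>Swapping the roles of the diagonals and changing the sign of a column have the same effect.
  So the choice of the positive handedness contributes only a global sign.\<close>

lemma column_sign_mult:
  assumes "ps ! i \<noteq> 0"
  shows "column_sign \<delta> ps i * int (nat \<bar>ps ! i\<bar>) = diagonal_sign \<delta> * ps ! i"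
  using assms by (auto simp: column_sign_def diagonal_sign_opposite)

lemma cong_diagonal_sign_mult:
  "[diagonal_sign \<delta> * x = diagonal_sign \<delta> * y] (mod m) \<longleftrightarrow> [x = y] (mod m)"
  by (cases \<delta>) (auto simp: cong_minus_minus_iff)

lemma ball_crossings_pretzel:
  "(\<forall>w\<in>crossings (pretzel_diagram \<delta> ps). Q w) \<longleftrightarrow>
   (\<forall>i<length ps. \<forall>k<nat \<bar>ps ! i\<bar>. Q (crossing_over (if ps ! i > 0 then \<delta> else opposite \<delta>) i k))"
  unfolding pretzel_diagram_def Let_def diagram.select_convs by blast

lemma darts_pretzel:
  "(i, k, x) \<in> darts (pretzel_diagram \<delta> ps) \<longleftrightarrow> i < length ps \<and> k < nat \<bar>ps ! i\<bar>"
proof -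
  have corners: "(i, k, x) \<notin> (case crossing_over \<gamma> j l of (a, b, c, d) \<Rightarrow> {a, b, c, d})
      \<longleftrightarrow> i \<noteq> j \<or> k \<noteq> l"
    for \<gamma> j l by (cases \<gamma>; cases x) auto
  have "(i, k, x) \<in> darts (pretzel_diagram \<delta> ps) \<longleftrightarrow>
    \<not> (\<forall>w\<in>crossings (pretzel_diagram \<delta> ps). (i, k, x) \<notin> (case w of (a, b, c, d) \<Rightarrow> {a, b, c, d}))"
    unfolding darts_def UN_iff ball_simps bex_simps by simp
  then show ?thesis
    unfolding ball_crossings_pretzel corners by blast
qed

lemma joins_pretzel_darts:
  assumes "0 \<notin> set ps"
  shows "joins (pretzel_diagram \<delta> ps) \<subseteq> darts (pretzel_diagram \<delta> ps) \<times> darts (pretzel_diagram \<delta> ps)"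
proof -
  have "ps ! i \<noteq> 0" if "i < length ps" for i
    using assms nth_mem[OF that] by auto
  moreover have "Suc i mod length ps < length ps" if "i < length ps" for i
    using that by (intro mod_less_divisor) auto
  ultimately show ?thesis
    unfolding subset_iff mem_Times_iff split_paired_All fst_conv snd_conv darts_pretzel
    by (auto simp: pretzel_diagram_def Let_def)
qed

text \<open>Let \<open>x\<close>, \<open>y\<close> be the colors on the left and right above a crossing. If the overcrossing strand
  rises, \<open>y\<close> continues to SW and \<open>x\<close> leaves as \<open>2 y - x\<close> at SE; if it falls, \<open>x\<close> continues to SE
  and \<open>y\<close> leaves as \<open>2 x - y\<close> at SW. In both cases the two colors are shifted by \<open>y - x\<close> or its
  negative, and their difference is preserved.\<close>

lemma crossing_color_iff:
  assumes "\<And>x. c (i, k, x) \<in> {0..<int n}"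
  shows "(case crossing_over \<gamma> i k of (u, v, u', v') \<Rightarrow>
      c v = c v' \<and> [c u + c u' = 2 * c v] (mod int n)) \<longleftrightarrow>
    [c (i, k, SW) = c (i, k, NW) + diagonal_sign \<gamma> * (c (i, k, NE) - c (i, k, NW))] (mod int n) \<and>
    [c (i, k, SE) = c (i, k, NE) + diagonal_sign \<gamma> * (c (i, k, NE) - c (i, k, NW))] (mod int n)"
proof -
  have eq: "c (i, k, x) = c (i, k, y) \<longleftrightarrow> [c (i, k, x) = c (i, k, y)] (mod int n)" for x y
    using assms[of x] assms[of y] by (auto simp: cong_def)
  have turn: "[a = b] (mod int n) \<and> [c + d = 2 * a] (mod int n) \<longleftrightarrow>
      [a = b] (mod int n) \<and> [d = b + (b - c)] (mod int n)" for a b c d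
  proof -
    have "[c + d = 2 * a] (mod int n) \<longleftrightarrow> [d = b + (b - c)] (mod int n)"
      if "[a = b] (mod int n)"
    proof -
      have "[2 * a = 2 * b] (mod int n)" using that by (rule cong_scalar_left)
      then show ?thesis by (smt (verit) cong_add_lcancel cong_sym cong_trans)
    qed
    then show ?thesis by auto
  qed
  show ?thesis
  proof (cases \<gamma>)
    case Rising
    show ?thesis
      using turn[of "c (i, k, SW)" "c (i, k, NE)" "c (i, k, NW)" "c (i, k, SE)"]
      by (simp add: Rising eq algebra_simps)
  next
    case Falling
    show ?thesis
      using turn[of "c (i, k, NW)" "c (i, k, NW)" "c (i, k, NE)" "c (i, k, SW)"]
      by (auto simp: Falling eq[of NW SE] cong_sym_eq[of "c (i, k, NW)" "c (i, k, SE)"] algebra_simps)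
  qed
qed

lemma dart_colorings_pretzel:
  fixes \<delta> n c
  assumes nz: "0 \<notin> set ps"
  defines "m \<equiv> length ps" and "q \<equiv> \<lambda>i. nat \<bar>ps ! i\<bar>" and "D \<equiv> pretzel_diagram \<delta> ps"
  shows "c \<in> dart_colorings D n \<longleftrightarrow> c \<in> darts D \<rightarrow>\<^sub>E {0..<int n} \<and>
    (\<forall>i<m. \<forall>k. Suc k < q i \<longrightarrow>
      c (i, k, SW) = c (i, Suc k, NW) \<and> c (i, k, SE) = c (i, Suc k, NE)) \<and>
    (\<forall>i<m. c (i, 0, NE) = c (Suc i mod m, 0, NW)) \<and>
    (\<forall>i<m. c (i, q i - 1, SE) = c (Suc i mod m, q (Suc i mod m) - 1, SW)) \<and>
    (\<forall>i<m. \<forall>k<q i.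
      [c (i, k, SW) = c (i, k, NW) + column_sign \<delta> ps i * (c (i, k, NE) - c (i, k, NW))] (mod int n) \<and>
      [c (i, k, SE) = c (i, k, NE) + column_sign \<delta> ps i * (c (i, k, NE) - c (i, k, NW))] (mod int n))"
    (is "_ \<longleftrightarrow> ?typed \<and> ?inner \<and> ?top \<and> ?bottom \<and> ?cross")
proof (cases "?typed")
  case True
  let ?\<gamma> = "\<lambda>i. if ps ! i > 0 then \<delta> else opposite \<delta>"
  have "c \<in> dart_colorings D n \<longleftrightarrow> (\<forall>(x, y)\<in>joins D. c x = c y) \<and>
      (\<forall>(u, v, u', v')\<in>crossings D. c v = c v' \<and> [c u + c u' = 2 * c v] (mod int n))"
    using True unfolding dart_colorings_def arc_steps_def by fastforce
  moreover have "(\<forall>(x, y)\<in>joins D. c x = c y) \<longleftrightarrow> ?inner \<and> ?top \<and> ?bottom"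
    unfolding D_def pretzel_diagram_def Let_def m_def q_def by (simp add: ball_Un) blast
  moreover have "(\<forall>w\<in>crossings D. Q w) \<longleftrightarrow> (\<forall>i<m. \<forall>k<q i. Q (crossing_over (?\<gamma> i) i k))" for Q
    unfolding D_def m_def q_def by (rule ball_crossings_pretzel)
  moreover have "(\<forall>i<m. \<forall>k<q i. case crossing_over (?\<gamma> i) i k of (u, v, u', v') \<Rightarrow>
      c v = c v' \<and> [c u + c u' = 2 * c v] (mod int n)) \<longleftrightarrow> ?cross"
  proof -
    have "c (i, k, x) \<in> {0..<int n}" if "i < m" "k < q i" for i k x
      using True that by (auto simp: D_def m_def q_def darts_pretzel PiE_iff)
    then show ?thesis
      unfolding column_sign_def by (intro all_cong1 imp_cong HOL.refl crossing_color_iff)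
  qed
  ultimately show ?thesis using True by (simp del: crossing_over.simps)
next
  case False
  then show ?thesis by (auto simp: dart_colorings_def)
qed

lemma int_cong_less_imp_eq:
  "[x = y] (mod int n) \<Longrightarrow> x \<in> {0..<int n} \<Longrightarrow> y \<in> {0..<int n} \<Longrightarrow> x = y"
  by (simp add: cong_def)

text \<open>Induction down the column: the difference of its two strands is invariant, and each crossing
  shifts both colors by that difference, up to sign.\<close>

lemma top_color_cong:
  assumes "0 \<notin> set ps" and c: "c \<in> dart_colorings (pretzel_diagram \<delta> ps) n"
    and "i < length ps" "k < nat \<bar>ps ! i\<bar>"
  shows "[c (i, k, x) = corner_color \<delta> ps (\<lambda>i. c (i, 0, NW)) (i, k, x)] (mod int n)"
proof -
  let ?m = "length ps" and ?a = "\<lambda>i. c (i, 0, NW)" and ?s = "column_sign \<delta> ps i"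
  let ?g = "gap ?m ?a i"
  note col = c[unfolded dart_colorings_pretzel[OF assms(1)]]
  have top: "c (i, 0, NE) = ?a (Suc i mod ?m)" using col assms(3) by blast
  have step: "[c (i, k, SW) = c (i, k, NW) + ?s * ?g] (mod int n) \<and>
      [c (i, k, SE) = c (i, k, NE) + ?s * ?g] (mod int n)"
    if "k < nat \<bar>ps ! i\<bar>" "[c (i, k, NE) - c (i, k, NW) = ?g] (mod int n)" for k
  proof -
    have "[x + ?s * (c (i, k, NE) - c (i, k, NW)) = x + ?s * ?g] (mod int n)" for x
      using that(2) by (intro cong_add cong_refl cong_scalar_left)
    moreover have "[c (i, k, SW) = c (i, k, NW) + ?s * (c (i, k, NE) - c (i, k, NW))] (mod int n) \<and>
      [c (i, k, SE) = c (i, k, NE) + ?s * (c (i, k, NE) - c (i, k, NW))] (mod int n)"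
      using col assms(3) that(1) by blast
    ultimately show ?thesis by (blast intro: cong_trans)
  qed
  have upper: "[c (i, k, NW) = ?a i + ?s * int k * ?g] (mod int n) \<and>
      [c (i, k, NE) = ?a (Suc i mod ?m) + ?s * int k * ?g] (mod int n)"
    and diff: "[c (i, k, NE) - c (i, k, NW) = ?g] (mod int n)"
    if "k < nat \<bar>ps ! i\<bar>" for k
  proof -
    show upper: "[c (i, k, NW) = ?a i + ?s * int k * ?g] (mod int n) \<and>
      [c (i, k, NE) = ?a (Suc i mod ?m) + ?s * int k * ?g] (mod int n)"
      using that
    proof (induction k)
      case 0
      then show ?case by (simp add: top)
    next
      case (Suc k)
      then have IH: "[c (i, k, NW) = ?a i + ?s * int k * ?g] (mod int n)"
        "[c (i, k, NE) = ?a (Suc i mod ?m) + ?s * int k * ?g] (mod int n)" by auto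
      have "[c (i, k, NE) - c (i, k, NW) = ?g] (mod int n)"
        using cong_diff[OF IH(2) IH(1)] by (simp add: gap_def)
      from step[OF _ this] Suc.prems
      have "[c (i, k, SW) = c (i, k, NW) + ?s * ?g] (mod int n)"
        "[c (i, k, SE) = c (i, k, NE) + ?s * ?g] (mod int n)" by auto
      moreover have "c (i, Suc k, NW) = c (i, k, SW)" "c (i, Suc k, NE) = c (i, k, SE)"
        using col assms(3) Suc.prems by auto
      ultimately show ?case
        using cong_trans[OF _ cong_add[OF IH(1) cong_refl[of "?s * ?g"]]]
          cong_trans[OF _ cong_add[OF IH(2) cong_refl[of "?s * ?g"]]]
        by (simp add: algebra_simps)
    qed
    then show "[c (i, k, NE) - c (i, k, NW) = ?g] (mod int n)"
      using cong_diff[OF conjunct2[OF upper] conjunct1[OF upper]] by (simp add: gap_def)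
  qed
  show ?thesis
    using upper[OF assms(4)] step[OF assms(4) diff[OF assms(4)]]
      cong_trans[OF _ cong_add[OF conjunct1[OF upper[OF assms(4)]] cong_refl[of "?s * ?g"]]]
      cong_trans[OF _ cong_add[OF conjunct2[OF upper[OF assms(4)]] cong_refl[of "?s * ?g"]]]
    by (cases x) (simp_all add: corner_color_def algebra_simps)
qed

text \<open>The number of crossings times the shift at each of them is the signed entry of the list, up to
  the global sign, so that the join between neighboring columns becomes an equation between their
  entries and gaps.\<close>

lemma bottom_corner_color:
  assumes "0 \<notin> set ps" and i: "i < length ps"
  shows "corner_color \<delta> ps a (i, nat \<bar>ps ! i\<bar> - 1, SE) =
    a (Suc i mod length ps) + diagonal_sign \<delta> * (ps ! i * gap (length ps) a i)"
    and "corner_color \<delta> ps a (i, nat \<bar>ps ! i\<bar> - 1, SW) =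
    a i + diagonal_sign \<delta> * (ps ! i * gap (length ps) a i)"
proof -
  have nz: "ps ! i \<noteq> 0" using assms(1) nth_mem[OF i] by auto
  then have "Suc (nat \<bar>ps ! i\<bar> - 1) = nat \<bar>ps ! i\<bar>" by simp
  then show "corner_color \<delta> ps a (i, nat \<bar>ps ! i\<bar> - 1, SE) =
    a (Suc i mod length ps) + diagonal_sign \<delta> * (ps ! i * gap (length ps) a i)"
    and "corner_color \<delta> ps a (i, nat \<bar>ps ! i\<bar> - 1, SW) =
    a i + diagonal_sign \<delta> * (ps ! i * gap (length ps) a i)"
    unfolding corner_color_def prod.case
    by (simp_all only: column_sign_mult[OF nz] mult.assoc[symmetric] corner.simps insert_iff empty_iff simp_thms if_True if_False)
qed

lemma cyclic_cong_const:
  fixes f :: "nat \<Rightarrow> int"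
  assumes "m > 0" and step: "\<And>i. i < m \<Longrightarrow> [f i = f (Suc i mod m)] (mod N)"
  shows "\<exists>t. \<forall>i<m. [f i = t] (mod N)"
proof -
  have "[f i = f 0] (mod N)" if "i < m" for i
    using that
  proof (induction i)
    case (Suc i)
    then have "[f i = f (Suc i)] (mod N)" using step[of i] by simp
    with Suc show ?case by (metis Suc_lessD cong_sym cong_trans)
  qed simp
  then show ?thesis by blast
qed

text \<open>A coloring is recovered from its NW colors by propagation. Inside the columns and along the top
  the propagated colors always fit together. The join from the SE end of column \<open>i\<close> to the SW end of
  the next one compares \<open>a (i + 1) \<plusminus> ps ! i * gap i\<close> with
  \<open>a (i + 1) \<plusminus> ps ! (i + 1) * gap (i + 1)\<close>, with the same sign on both sides.\<close>

lemma bij_betw_dart_top_colorings: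
  assumes nz: "0 \<notin> set ps" and ps: "ps \<noteq> []" and n: "n > 0"
  shows "bij_betw (\<lambda>c. \<lambda>i\<in>{..<length ps}. c (i, 0, NW))
    (dart_colorings (pretzel_diagram \<delta> ps) n) (top_colorings ps n)"
    (is "bij_betw ?f ?C ?T")
proof -
  let ?m = "length ps" and ?D = "pretzel_diagram \<delta> ps" and ?Z = "{0..<int n}"
  let ?q = "\<lambda>i. nat \<bar>ps ! i\<bar>"
  have m: "?m > 0" using ps by simp
  have right: "Suc i mod ?m < ?m" for i using m by simp
  have q: "?q i > 0" if "i < ?m" for i
    using nz nth_mem[OF that] by (metis nat_0_iff abs_le_zero_iff bot_nat_0.not_eq_extremum)
  have corner_cong: "corner_color \<delta> ps a (i, k, x) = corner_color \<delta> ps a' (i, k, x)"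
    if "\<And>j. j < ?m \<Longrightarrow> a j = a' j" "i < ?m" for a a' i k x
    using that right by (simp add: corner_color_def gap_def)
  have typed: "c \<in> darts ?D \<rightarrow>\<^sub>E ?Z" if "c \<in> ?C" for c
    using that by (simp add: dart_colorings_def)
  have "inj_on ?f ?C"
  proof (rule inj_onI)
    fix c c' assume c: "c \<in> ?C" "c' \<in> ?C" and eq: "?f c = ?f c'"
    have a: "c (j, 0, NW) = c' (j, 0, NW)" if "j < ?m" for j
      using fun_cong[OF eq, of j] that by simp
    show "c = c'"
    proof (rule PiE_ext[OF typed[OF c(1)] typed[OF c(2)]])
      fix y assume y: "y \<in> darts ?D"
      obtain i k x where ikx: "y = (i, k, x)" by (cases y)
      with y have i: "i < ?m" "k < ?q i" by (simp_all add: darts_pretzel)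
      have "corner_color \<delta> ps (\<lambda>i. c (i, 0, NW)) (i, k, x) =
          corner_color \<delta> ps (\<lambda>i. c' (i, 0, NW)) (i, k, x)"
        by (rule corner_cong[OF a i(1)])
      then have "[c y = c' y] (mod int n)"
        using top_color_cong[OF nz c(1) i, of x] top_color_cong[OF nz c(2) i, of x]
        unfolding ikx cong_def by simp
      then show "c y = c' y"
        using PiE_mem[OF typed[OF c(1)] y] PiE_mem[OF typed[OF c(2)] y]
        by (rule int_cong_less_imp_eq)
    qed
  qed
  moreover have "?f c \<in> ?T" if c: "c \<in> ?C" for c
  proof -
    let ?a = "\<lambda>i. c (i, 0, NW)"
    have "?f c \<in> {..<?m} \<rightarrow>\<^sub>E ?Z"
      using typed[OF c] q by (auto simp: PiE_iff darts_pretzel)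
    moreover have "\<exists>t. \<forall>i<?m. [ps ! i * gap ?m ?a i = t] (mod int n)"
    proof (rule cyclic_cong_const[OF m])
      fix i assume i: "i < ?m"
      let ?j = "Suc i mod ?m"
      have "c (i, ?q i - 1, SE) = c (?j, ?q ?j - 1, SW)"
        using c i unfolding dart_colorings_pretzel[OF nz] by blast
      moreover have "?q i - 1 < ?q i" "?q ?j - 1 < ?q ?j"
        using q[OF i] q[OF right[of i]] by simp_all
      ultimately have "[corner_color \<delta> ps ?a (i, ?q i - 1, SE) =
          corner_color \<delta> ps ?a (?j, ?q ?j - 1, SW)] (mod int n)"
        using top_color_cong[OF nz c i, of "?q i - 1" SE]
          top_color_cong[OF nz c right[of i], of "?q ?j - 1" SW]
        unfolding cong_def by (simp only:)
      then show "[ps ! i * gap ?m ?a i = ps ! ?j * gap ?m ?a ?j] (mod int n)"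
        unfolding bottom_corner_color[OF nz i] bottom_corner_color[OF nz right]
        by (simp only: cong_add_lcancel cong_diagonal_sign_mult)
    qed
    moreover have "gap ?m (?f c) i = gap ?m ?a i" if "i < ?m" for i
      using that right by (simp add: gap_def)
    ultimately show ?thesis by (simp add: top_colorings_def)
  qed
  moreover have "a \<in> ?f ` ?C" if a: "a \<in> ?T" for a
  proof -
    define c where "c = (\<lambda>y\<in>darts ?D. corner_color \<delta> ps a y mod int n)"
    have c_eq: "c (i, k, x) = corner_color \<delta> ps a (i, k, x) mod int n" if "i < ?m" "k < ?q i" for i k x
      using that by (simp add: c_def darts_pretzel)
    have c_cong: "[c (i, k, x) = corner_color \<delta> ps a (i, k, x)] (mod int n)"
      if "i < ?m" "k < ?q i" for i k x
      using c_eq[OF that] by (simp add: cong_def)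
    have "c \<in> ?C"
      unfolding dart_colorings_pretzel[OF nz]
    proof (intro conjI allI impI)
      show "c \<in> darts ?D \<rightarrow>\<^sub>E ?Z" using n by (auto simp: c_def)
      show "c (i, k, SW) = c (i, Suc k, NW)" "c (i, k, SE) = c (i, Suc k, NE)"
        if "i < ?m" "Suc k < ?q i" for i k
        using that by (simp_all add: c_eq corner_color_def)
      show "c (i, 0, NE) = c (Suc i mod ?m, 0, NW)" if i: "i < ?m" for i
        by (simp add: c_eq[OF i q[OF i]] c_eq[OF right q[OF right]] corner_color_def)
      show "c (i, ?q i - 1, SE) = c (Suc i mod ?m, ?q (Suc i mod ?m) - 1, SW)" if i: "i < ?m" for i
      proof -
        let ?j = "Suc i mod ?m"
        obtain t where t: "\<And>i. i < ?m \<Longrightarrow> [ps ! i * gap ?m a i = t] (mod int n)"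
          using a by (auto simp: top_colorings_def)
        have "[ps ! i * gap ?m a i = ps ! ?j * gap ?m a ?j] (mod int n)"
          using t[OF i] t[OF right[of i]] by (metis cong_sym cong_trans)
        then have "[corner_color \<delta> ps a (i, ?q i - 1, SE) =
            corner_color \<delta> ps a (?j, ?q ?j - 1, SW)] (mod int n)"
          unfolding bottom_corner_color[OF nz i] bottom_corner_color[OF nz right]
          by (simp only: cong_add_lcancel cong_diagonal_sign_mult)
        moreover have "?q i - 1 < ?q i" "?q ?j - 1 < ?q ?j"
          using q[OF i] q[OF right[of i]] by auto
        ultimately show ?thesis
          using c_eq[OF i, of "?q i - 1" SE] c_eq[OF right, of "?q ?j - 1" i SW]
          unfolding cong_def by (simp only:)
      qed
      show "[c (i, k, SW) = c (i, k, NW) + column_sign \<delta> ps i * (c (i, k, NE) - c (i, k, NW))] (mod int n)"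
        "[c (i, k, SE) = c (i, k, NE) + column_sign \<delta> ps i * (c (i, k, NE) - c (i, k, NW))] (mod int n)"
        if ik: "i < ?m" "k < ?q i" for i k
      proof -
        let ?k = "\<lambda>x. corner_color \<delta> ps a (i, k, x)" and ?s = "column_sign \<delta> ps i"
        have "[c (i, k, x) + ?s * (c (i, k, NE) - c (i, k, NW)) = ?k x + ?s * (?k NE - ?k NW)] (mod int n)"
          for x using c_cong[OF ik] by (intro cong_add cong_scalar_left cong_diff)
        moreover have "?k NW + ?s * (?k NE - ?k NW) = ?k SW" "?k NE + ?s * (?k NE - ?k NW) = ?k SE"
          by (simp_all add: corner_color_def gap_def algebra_simps)
        ultimately show
          "[c (i, k, SW) = c (i, k, NW) + ?s * (c (i, k, NE) - c (i, k, NW))] (mod int n)"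
          "[c (i, k, SE) = c (i, k, NE) + ?s * (c (i, k, NE) - c (i, k, NW))] (mod int n)"
          using c_cong[OF ik, of SW] c_cong[OF ik, of SE] by (simp_all add: cong_def)
      qed
    qed
    moreover have "?f c = a"
    proof (rule PiE_ext[of _ "{..<?m}" "\<lambda>_. ?Z"])
      show "a \<in> {..<?m} \<rightarrow>\<^sub>E ?Z" using a by (simp add: top_colorings_def)
      show "?f c \<in> {..<?m} \<rightarrow>\<^sub>E ?Z" using n q by (auto simp: c_eq)
      fix i assume i: "i \<in> {..<?m}"
      then have "a i \<in> ?Z" using a by (auto simp: top_colorings_def)
      then show "?f c i = a i" using i q by (simp add: c_eq corner_color_def)
    qed
    ultimately show ?thesis by blast
  qed
  ultimately show ?thesis by (intro bij_betw_imageI equalityI image_subsetI subsetI)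
qed

lemma card_hom_pretzel:
  assumes nz: "0 \<notin> set ps" and ps: "ps \<noteq> []" and n: "n > 0"
  shows "card (quandle_hom (fundamental_quandle (pretzel_diagram \<delta> ps) inc) (dihedral_quandle n))
    = card (top_colorings ps n)"
  using card_hom_fundamental_dihedral[OF n joins_pretzel_darts[OF nz]]
    bij_betw_same_card[OF bij_betw_dart_top_colorings[OF nz ps n]] by simp

section \<open>Counting the colorings of the top strands\<close>

text \<open>The sum vanishes because the columns are arranged in a cycle.\<close>

definition closed_gaps :: "int list \<Rightarrow> nat \<Rightarrow> (nat \<Rightarrow> int) set" where
  "closed_gaps ps n = {d \<in> {..<length ps} \<rightarrow>\<^sub>E {0..<int n}.
     [(\<Sum>i<length ps. d i) = 0] (mod int n) \<and>
     (\<exists>t. \<forall>i<length ps. [ps ! i * d i = t] (mod int n))}"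

lemma sum_gap: "m > 0 \<Longrightarrow> (\<Sum>i<m. gap m a i) = 0"
proof (cases m)
  case (Suc m')
  have "(\<Sum>i<m'. gap m a i) = (\<Sum>i<m'. a (Suc i) - a i)"
    using Suc by (intro sum.cong) (auto simp: gap_def)
  then show ?thesis by (simp add: Suc gap_def sum_lessThan_telescope)
qed simp

text \<open>A cyclic sequence amounts to its first entry and its differences, which are arbitrary up to
  having sum zero.\<close>

lemma card_top_colorings:
  assumes n: "n > 0" and ps: "ps \<noteq> []"
  shows "card (top_colorings ps n) = n * card (closed_gaps ps n)"
proof -
  let ?m = "length ps" and ?Z = "{0..<int n}"
  have m: "?m > 0" using ps by simp
  define f where "f = (\<lambda>a. (a 0, \<lambda>i\<in>{..<?m}. gap ?m a i mod int n))"
  define g where "g = (\<lambda>(x, d). \<lambda>i\<in>{..<?m}. (x + (\<Sum>j<i. d j)) mod int n)"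
  have gap_g: "[gap ?m (g (x, d)) i = d i] (mod int n)"
    if d: "d \<in> closed_gaps ps n" and i: "i < ?m" for x d i
  proof (cases "Suc i < ?m")
    case True
    then have "gap ?m (g (x, d)) i = (x + (\<Sum>j<Suc i. d j)) mod int n - (x + (\<Sum>j<i. d j)) mod int n"
      by (simp add: gap_def g_def)
    also have "[\<dots> = (x + (\<Sum>j<Suc i. d j)) - (x + (\<Sum>j<i. d j))] (mod int n)"
      by (intro cong_diff) (simp_all add: cong_def)
    finally show ?thesis by simp
  next
    case False
    with i have mi: "?m = Suc i" by simp
    then have "gap ?m (g (x, d)) i = x mod int n - (x + (\<Sum>j<i. d j)) mod int n"
      by (simp add: gap_def g_def)
    also have "[\<dots> = x - (x + (\<Sum>j<i. d j))] (mod int n)"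
      by (intro cong_diff) (simp_all add: cong_def)
    also have "x - (x + (\<Sum>j<i. d j)) = d i - (\<Sum>j<?m. d j)"
      by (simp add: mi)
    also have "[\<dots> = d i - 0] (mod int n)"
      using d by (intro cong_diff cong_refl) (simp add: closed_gaps_def)
    finally show ?thesis by simp
  qed
  have f_in: "f a \<in> ?Z \<times> closed_gaps ps n" if a: "a \<in> top_colorings ps n" for a
  proof -
    have "[(\<Sum>i<?m. gap ?m a i mod int n) = (\<Sum>i<?m. gap ?m a i)] (mod int n)"
      by (intro cong_sum) (simp add: cong_def)
    then have "[(\<Sum>i<?m. gap ?m a i mod int n) = 0] (mod int n)"
      by (simp add: sum_gap[OF m])
    moreover obtain t where "\<forall>i<?m. [ps ! i * gap ?m a i = t] (mod int n)"
      using a by (auto simp: top_colorings_def)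
    then have "\<forall>i<?m. [ps ! i * (gap ?m a i mod int n) = t] (mod int n)"
      by (simp add: cong_def mod_mult_right_eq)
    ultimately show ?thesis
      using a n m by (auto simp: f_def closed_gaps_def top_colorings_def PiE_iff)
  qed
  have g_in: "g z \<in> top_colorings ps n" if z: "z \<in> ?Z \<times> closed_gaps ps n" for z
  proof -
    obtain x d where xd: "z = (x, d)" "d \<in> closed_gaps ps n" using z by auto
    obtain t where "\<forall>i<?m. [ps ! i * d i = t] (mod int n)"
      using xd by (auto simp: closed_gaps_def)
    then have "\<forall>i<?m. [ps ! i * gap ?m (g z) i = t] (mod int n)"
      using gap_g[OF xd(2)] xd(1) by (meson cong_scalar_left cong_trans)
    then show ?thesis using n by (auto simp: top_colorings_def xd(1) g_def)
  qed
  have gf: "g (f a) = a" if a: "a \<in> top_colorings ps n" for a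
  proof (rule PiE_ext)
    show "g (f a) \<in> {..<?m} \<rightarrow>\<^sub>E ?Z" "a \<in> {..<?m} \<rightarrow>\<^sub>E ?Z"
      using g_in[OF f_in[OF a]] a by (auto simp: top_colorings_def)
    fix i assume i: "i \<in> {..<?m}"
    have "(\<Sum>j<i. snd (f a) j) = (\<Sum>j<i. gap ?m a j mod int n)"
      using i by (intro sum.cong) (auto simp: f_def)
    also have "[\<dots> = (\<Sum>j<i. gap ?m a j)] (mod int n)"
      by (intro cong_sum) (simp add: cong_def)
    also have "(\<Sum>j<i. gap ?m a j) = (\<Sum>j<i. a (Suc j) - a j)"
      using i by (intro sum.cong) (auto simp: gap_def)
    also have "\<dots> = a i - a 0" by (rule sum_lessThan_telescope)
    finally have "[a 0 + (\<Sum>j<i. snd (f a) j) = a 0 + (a i - a 0)] (mod int n)"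
      by (rule cong_add[OF cong_refl])
    then have "(a 0 + (\<Sum>j<i. snd (f a) j)) mod int n = a i mod int n" by (simp add: cong_def)
    also have "\<dots> = a i" using a i by (auto simp: top_colorings_def PiE_iff)
    finally show "g (f a) i = a i" using i by (simp add: g_def f_def)
  qed
  have fg: "f (g z) = z" if z: "z \<in> ?Z \<times> closed_gaps ps n" for z
  proof -
    obtain x d where xd: "z = (x, d)" "x \<in> ?Z" "d \<in> closed_gaps ps n" using z by auto
    have "snd (f (g z)) = d"
    proof (rule PiE_ext)
      show "snd (f (g z)) \<in> {..<?m} \<rightarrow>\<^sub>E ?Z" "d \<in> {..<?m} \<rightarrow>\<^sub>E ?Z"
        using f_in[OF g_in[OF z]] xd(3) by (auto simp: closed_gaps_def)
      fix i assume i: "i \<in> {..<?m}"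
      then have "d i \<in> ?Z" using xd(3) by (auto simp: closed_gaps_def)
      then show "snd (f (g z)) i = d i"
        using gap_g[OF xd(3), of i x] i by (simp add: f_def xd(1) cong_def)
    qed
    moreover have "fst (f (g z)) = x" using xd m by (simp add: f_def g_def)
    ultimately show ?thesis by (simp add: xd(1) prod_eq_iff)
  qed
  have "bij_betw f (top_colorings ps n) (?Z \<times> closed_gaps ps n)"
    using f_in g_in gf fg by (intro bij_betw_byWitness[of _ g] ballI image_subsetI)
  then show ?thesis by (simp add: bij_betw_same_card card_cartesian_product)
qed

text \<open>An entry that vanishes modulo \<open>n\<close> forces the common value of the products to be zero. Then the
  gaps at invertible entries vanish, and those at the vanishing entries are subject only to the
  zero sum condition, which determines one of them by the others.\<close>

lemma card_closed_gaps_zero: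
  assumes n: "prime n" and ex: "\<exists>i<length ps. int n dvd ps ! i"
  shows "card (closed_gaps ps n) = n ^ (card {i. i < length ps \<and> int n dvd ps ! i} - 1)"
proof -
  let ?m = "length ps" and ?Z = "{0..<int n}"
  let ?I = "{i. i < ?m \<and> int n dvd ps ! i}"
  obtain z where z: "z \<in> ?I" using ex by blast
  have prime: "prime (int n)" using n by simp
  have npos: "n > 0" using n by (rule prime_gt_0_nat)
  have closed_iff: "d \<in> closed_gaps ps n \<longleftrightarrow>
      [(\<Sum>i\<in>?I. d i) = 0] (mod int n) \<and> (\<forall>i<?m. \<not> int n dvd ps ! i \<longrightarrow> d i = 0)"
    if d: "d \<in> {..<?m} \<rightarrow>\<^sub>E ?Z" for d
  proof -
    have "(\<exists>t. \<forall>i<?m. [ps ! i * d i = t] (mod int n)) \<longleftrightarrow> (\<forall>i<?m. [ps ! i * d i = 0] (mod int n))"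
    proof
      assume "\<exists>t. \<forall>i<?m. [ps ! i * d i = t] (mod int n)"
      then obtain t where t: "\<And>i. i < ?m \<Longrightarrow> [ps ! i * d i = t] (mod int n)" by blast
      have "[ps ! z * d z = 0] (mod int n)" using z by (simp add: cong_0_iff)
      moreover have "[ps ! z * d z = t] (mod int n)" using z by (intro t) simp
      ultimately have "[t = 0] (mod int n)" by (rule cong_trans[OF cong_sym, rotated])
      then show "\<forall>i<?m. [ps ! i * d i = 0] (mod int n)" using t by (blast intro: cong_trans)
    next
      assume "\<forall>i<?m. [ps ! i * d i = 0] (mod int n)"
      then show "\<exists>t. \<forall>i<?m. [ps ! i * d i = t] (mod int n)" by (rule exI)
    qed
    also have "\<dots> \<longleftrightarrow> (\<forall>i<?m. \<not> int n dvd ps ! i \<longrightarrow> d i = 0)"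
    proof -
      have "[ps ! i * d i = 0] (mod int n) \<longleftrightarrow> (\<not> int n dvd ps ! i \<longrightarrow> d i = 0)" if "i < ?m" for i
      proof -
        have "d i \<in> ?Z" by (rule PiE_mem[OF d]) (simp add: that)
        then have "int n dvd d i \<longleftrightarrow> d i = 0" by (auto simp: dvd_eq_mod_eq_0)
        then show ?thesis unfolding cong_0_iff prime_dvd_mult_iff[OF prime] by argo
      qed
      then show ?thesis by (intro all_cong1) simp
    qed
    finally have iff: "(\<exists>t. \<forall>i<?m. [ps ! i * d i = t] (mod int n)) \<longleftrightarrow>
      (\<forall>i<?m. \<not> int n dvd ps ! i \<longrightarrow> d i = 0)" .
    have "(\<Sum>i<?m. d i) = (\<Sum>i\<in>?I. d i)" if "\<forall>i<?m. \<not> int n dvd ps ! i \<longrightarrow> d i = 0"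
      using that by (intro sum.mono_neutral_right) auto
    then show ?thesis using d iff by (auto simp: closed_gaps_def)
  qed
  \<comment> \<open>The gap at \<open>z\<close> is the dependent one.\<close>
  let ?J = "?I - {z}"
  let ?f = "\<lambda>d. restrict d ?J"
  let ?g = "\<lambda>e. \<lambda>i\<in>{..<?m}. if i \<in> ?J then e i else if i = z then (- (\<Sum>j\<in>?J. e j)) mod int n else 0"
  have split: "(\<Sum>i\<in>?I. d i) = d z + (\<Sum>i\<in>?J. d i)" for d :: "nat \<Rightarrow> int"
    using z by (intro sum.remove) auto
  have sum_g: "(\<Sum>i\<in>?J. ?g e i) = (\<Sum>i\<in>?J. e i)" for e
    by (intro sum.cong) auto
  have "bij_betw ?f (closed_gaps ps n) (?J \<rightarrow>\<^sub>E ?Z)"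
  proof (rule bij_betw_byWitness[of _ ?g])
    show "\<forall>d\<in>closed_gaps ps n. ?g (?f d) = d"
    proof
      fix d assume d: "d \<in> closed_gaps ps n"
      then have dZ: "d \<in> {..<?m} \<rightarrow>\<^sub>E ?Z" by (simp add: closed_gaps_def)
      note d' = d[unfolded closed_iff[OF dZ] split]
      have "[d z = - (\<Sum>i\<in>?J. d i)] (mod int n)"
        using d' by (simp add: cong_iff_dvd_diff)
      moreover have "d z \<in> ?Z" by (rule PiE_mem[OF dZ]) (use z in simp)
      ultimately have dz: "(- (\<Sum>i\<in>?J. d i)) mod int n = d z" by (simp add: cong_def)
      have sum_f: "(\<Sum>i\<in>?J. ?f d i) = (\<Sum>i\<in>?J. d i)" by (intro sum.cong) simp_all
      show "?g (?f d) = d"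
      proof
        fix i
        consider "i \<in> ?J" | "i = z" | "i < ?m" "\<not> int n dvd ps ! i" "i \<noteq> z" | "\<not> i < ?m" by blast
        then show "?g (?f d) i = d i"
        proof cases
          case 2
          then show ?thesis using z unfolding sum_f dz by simp
        next
          case 4
          then show ?thesis using PiE_arb[OF dZ, of i] by simp
        qed (use d' in simp_all)
      qed
    qed
    show "\<forall>e\<in>?J \<rightarrow>\<^sub>E ?Z. ?f (?g e) = e"
    proof
      fix e assume e: "e \<in> ?J \<rightarrow>\<^sub>E ?Z"
      show "?f (?g e) = e"
      proof
        fix i
        show "?f (?g e) i = e i"
        proof (cases "i \<in> ?J")
          case False
          then show ?thesis by (simp only: restrict_apply PiE_arb[OF e False] if_False)
        qed simp
      qed
    qed
    show "?f ` closed_gaps ps n \<subseteq> ?J \<rightarrow>\<^sub>E ?Z"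
    proof (intro image_subsetI PiE_I)
      fix d i assume d: "d \<in> closed_gaps ps n" and i: "i \<in> ?J"
      then have "d \<in> {..<?m} \<rightarrow>\<^sub>E ?Z" by (simp add: closed_gaps_def)
      then have "d i \<in> ?Z" by (rule PiE_mem) (use i in simp)
      then show "?f d i \<in> ?Z" using i by simp
    qed (simp only: restrict_apply if_False)
    show "?g ` (?J \<rightarrow>\<^sub>E ?Z) \<subseteq> closed_gaps ps n"
    proof (rule image_subsetI)
      fix e assume e: "e \<in> ?J \<rightarrow>\<^sub>E ?Z"
      have gZ: "?g e \<in> {..<?m} \<rightarrow>\<^sub>E ?Z"
      proof (rule PiE_I)
        show "?g e i \<in> ?Z" if "i \<in> {..<?m}" for i
        proof (cases "i \<in> ?J")
          case True
          then show ?thesis using PiE_mem[OF e True] by simp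
        next
          case False
          then show ?thesis using that npos by auto
        qed
      qed simp
      have "?g e z = (- (\<Sum>j\<in>?J. e j)) mod int n" using z by simp
      then have "[?g e z + (\<Sum>i\<in>?J. e i) = - (\<Sum>j\<in>?J. e j) + (\<Sum>i\<in>?J. e i)] (mod int n)"
        by (intro cong_add cong_refl) (simp add: cong_def)
      then show "?g e \<in> closed_gaps ps n"
        unfolding closed_iff[OF gZ] split[of "?g e"] sum_g using z by simp
    qed
  qed
  then have "card (closed_gaps ps n) = card (?J \<rightarrow>\<^sub>E ?Z)" by (rule bij_betw_same_card)
  also have "\<dots> = n ^ (card ?I - 1)" using z by (simp add: card_funcsetE)
  finally show ?thesis .
qed

text \<open>If all entries are invertible, the common value \<open>t\<close> of the products determines the gaps as
  \<open>t / ps ! i\<close>, and their sum vanishes if and only if \<open>t\<close> times the sum of the inverses does. Over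
  a common denominator that sum of inverses has the numerator in the statement, an elementary symmetric
  polynomial of the entries.\<close>

lemma card_closed_gaps_unit:
  assumes n: "prime n" and ps: "ps \<noteq> []" and units: "\<forall>i<length ps. \<not> int n dvd ps ! i"
  shows "card (closed_gaps ps n) =
    (if int n dvd (\<Sum>i<length ps. \<Prod>j\<in>{..<length ps} - {i}. ps ! j) then n else 1)"
proof -
  let ?m = "length ps" and ?Z = "{0..<int n}"
  let ?e = "\<Sum>i<?m. \<Prod>j\<in>{..<?m} - {i}. ps ! j"
  have m: "?m > 0" using ps by simp
  have prime: "prime (int n)" using n by simp
  have npos: "n > 0" using n by (rule prime_gt_0_nat)
  have coprime: "coprime (ps ! i) (int n)" if "i < ?m" for i
    using prime_imp_coprime[OF prime] units that coprime_commute by blast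
  then have "\<forall>i\<in>{..<?m}. \<exists>v. [ps ! i * v = 1] (mod int n)"
    by (simp add: cong_solve_coprime_int)
  then obtain u where u: "\<And>i. i < ?m \<Longrightarrow> [ps ! i * u i = 1] (mod int n)"
    by (metis lessThan_iff)
  \<comment> \<open>\<open>u\<close> consists of inverses modulo \<open>n\<close>.\<close>
  let ?s = "\<Sum>i<?m. u i"
  have "[(\<Prod>j<?m. ps ! j) * ?s = ?e] (mod int n)"
    unfolding sum_distrib_left
  proof (rule cong_sum)
    fix i assume i: "i \<in> {..<?m}"
    then have "(\<Prod>j<?m. ps ! j) * u i = (\<Prod>j\<in>{..<?m} - {i}. ps ! j) * (ps ! i * u i)"
      by (simp add: prod.remove ac_simps)
    also have "[\<dots> = (\<Prod>j\<in>{..<?m} - {i}. ps ! j) * 1] (mod int n)"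
      using u i by (intro cong_scalar_left) simp
    finally show "[(\<Prod>j<?m. ps ! j) * u i = (\<Prod>j\<in>{..<?m} - {i}. ps ! j)] (mod int n)" by simp
  qed
  then have "int n dvd ?e \<longleftrightarrow> int n dvd (\<Prod>j<?m. ps ! j) * ?s"
    by (rule cong_dvd_iff[symmetric])
  also have "\<dots> \<longleftrightarrow> int n dvd ?s"
    using units by (simp add: prime_dvd_mult_iff[OF prime] prime_dvd_prod_iff[OF _ prime])
  finally have e_iff: "int n dvd ?e \<longleftrightarrow> int n dvd ?s" .
  let ?T = "{t \<in> ?Z. int n dvd t * ?s}"
  let ?f = "\<lambda>t. \<lambda>i\<in>{..<?m}. (t * u i) mod int n"
  have mult_f: "[ps ! i * (t * u i mod int n) = t] (mod int n)" if "i < ?m" for t i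
  proof -
    have "[ps ! i * (t * u i mod int n) = t * (ps ! i * u i)] (mod int n)"
      by (simp add: cong_def mod_mult_right_eq ac_simps)
    also have "[t * (ps ! i * u i) = t * 1] (mod int n)"
      using u[OF that] by (rule cong_scalar_left)
    finally show ?thesis by simp
  qed
  have sum_f: "[(\<Sum>i<?m. t * u i mod int n) = t * ?s] (mod int n)" for t
    unfolding sum_distrib_left by (intro cong_sum) (simp add: cong_def)
  have "bij_betw ?f ?T (closed_gaps ps n)"
  proof (rule bij_betw_imageI)
    show "inj_on ?f ?T"
    proof (rule inj_onI)
      fix t t' assume t: "t \<in> ?T" "t' \<in> ?T" and eq: "?f t = ?f t'"
      have "t * u 0 mod int n = t' * u 0 mod int n" using fun_cong[OF eq, of 0] ps by simp
      then have "[t = t'] (mod int n)"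
        using mult_f[OF m, of t] mult_f[OF m, of t'] by (metis cong_sym cong_trans)
      then show "t = t'" using t by (auto intro: int_cong_less_imp_eq)
    qed
    show "?f ` ?T = closed_gaps ps n"
    proof (intro equalityI subsetI)
      fix d assume "d \<in> ?f ` ?T"
      then obtain t where t: "t \<in> ?T" "d = ?f t" by blast
      have "[(\<Sum>i<?m. t * u i mod int n) = 0] (mod int n)"
        using t(1) cong_dvd_iff[OF sum_f[of t]] by (simp add: cong_0_iff)
      then show "d \<in> closed_gaps ps n"
        using mult_f[of _ t] npos by (auto simp: t(2) closed_gaps_def)
    next
      fix d assume d: "d \<in> closed_gaps ps n"
      then obtain t where t: "\<And>i. i < ?m \<Longrightarrow> [ps ! i * d i = t] (mod int n)"
        by (auto simp: closed_gaps_def)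
      let ?t = "t mod int n"
      have du: "?t * u i mod int n = d i" if i: "i < ?m" for i
      proof -
        have "[?t * u i = t * u i] (mod int n)" by (simp add: cong_def mod_mult_left_eq)
        also have "[t * u i = ps ! i * d i * u i] (mod int n)"
          using t[OF i] by (intro cong_scalar_right) (rule cong_sym)
        also have "ps ! i * d i * u i = d i * (ps ! i * u i)" by simp
        also have "[\<dots> = d i * 1] (mod int n)" using u[OF i] by (rule cong_scalar_left)
        finally have "[?t * u i = d i] (mod int n)" by simp
        moreover have "d i \<in> ?Z" using d i by (auto simp: closed_gaps_def)
        ultimately show ?thesis by (simp add: cong_def)
      qed
      have "?f ?t = d"
        using d du by (auto simp: closed_gaps_def fun_eq_iff PiE_iff extensional_def)
      moreover have "int n dvd ?t * ?s"
      proof -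
        have "(\<Sum>i<?m. ?t * u i mod int n) = (\<Sum>i<?m. d i)" by (intro sum.cong) (auto simp: du)
        then have "[?t * ?s = 0] (mod int n)"
          using sum_f[of ?t] d by (metis (mono_tags, lifting) closed_gaps_def cong_sym cong_trans mem_Collect_eq)
        then show ?thesis by (simp add: cong_0_iff)
      qed
      ultimately show "d \<in> ?f ` ?T" using npos by (intro image_eqI[of _ _ ?t]) auto
    qed
  qed
  then have "card (closed_gaps ps n) = card ?T" by (simp add: bij_betw_same_card)
  also have "\<dots> = (if int n dvd ?s then n else 1)"
  proof (cases "int n dvd ?s")
    case True
    then have "?T = ?Z" by auto
    with True show ?thesis by simp
  next
    case False
    have "t = 0" if "t \<in> ?T" for t
      using that False zdvd_not_zless[of t "int n"] by (fastforce simp: prime_dvd_mult_iff[OF prime])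
    then have "?T = {0}" using npos by auto
    with False show ?thesis by simp
  qed
  finally show ?thesis by (simp add: e_iff)
qed

lemma card_top_colorings_prime:
  assumes n: "prime n" and ps: "ps \<noteq> []"
  shows "card (top_colorings ps n) =
    (if \<exists>i<length ps. int n dvd ps ! i then n ^ card {i. i < length ps \<and> int n dvd ps ! i}
     else if int n dvd (\<Sum>i<length ps. \<Prod>j\<in>{..<length ps} - {i}. ps ! j) then n ^ 2 else n)"
proof (cases "\<exists>i<length ps. int n dvd ps ! i")
  case True
  let ?I = "{i. i < length ps \<and> int n dvd ps ! i}"
  have "card ?I > 0" using True by (auto simp: card_gt_0_iff)
  then have "n * n ^ (card ?I - 1) = n ^ card ?I" by (cases "card ?I") auto
  then show ?thesis
    using True card_top_colorings[OF prime_gt_0_nat[OF n] ps] card_closed_gaps_zero[OF n True] by simp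
next
  case False
  then show ?thesis
    using card_top_colorings[OF prime_gt_0_nat[OF n] ps] card_closed_gaps_unit[OF n ps]
    by (auto simp: power2_eq_square)
qed

section \<open>Four columns\<close>

lemma lessThan_4: "{..<4::nat} = {0, 1, 2, 3}" by auto

text \<open>The maximum accounts for the constant colorings, which remain when no entry vanishes modulo \<open>n\<close>.\<close>

lemma card_top_colorings_4:
  assumes "prime n"
  shows "card (top_colorings [a, b, c, d] n) =
    (let r = card {i. i < 4 \<and> int n dvd [a, b, c, d] ! i} in
     if r = 0 \<and> int n dvd b * c * d + a * c * d + a * b * d + a * b * c then n ^ 2
     else n ^ max 1 r)"
proof -
  let ?ps = "[a, b, c, d]"
  have "{..<4} - {0} = {1, 2, 3::nat}" "{..<4} - {1} = {0, 2, 3::nat}"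
    "{..<4} - {2} = {0, 1, 3::nat}" "{..<4} - {3} = {0, 1, 2::nat}" by auto
  then have e: "(\<Sum>i<4. \<Prod>j\<in>{..<4} - {i}. ?ps ! j) = b * c * d + a * c * d + a * b * d + a * b * c"
    by (simp add: lessThan_4 numeral_3_eq_3)
  have ex: "(\<exists>i<4. int n dvd ?ps ! i) \<longleftrightarrow> 0 < card {i. i < 4 \<and> int n dvd ?ps ! i}"
    by (auto simp: card_gt_0_iff)
  have len: "length ?ps = 4" by simp
  define r where "r = card {i. i < 4 \<and> int n dvd ?ps ! i}"
  have "card (top_colorings ?ps n) =
      (if 0 < r then n ^ r
       else if int n dvd b * c * d + a * c * d + a * b * d + a * b * c then n ^ 2 else n)"
    using card_top_colorings_prime[OF assms, of ?ps, unfolded len e ex, folded r_def] by blast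
  then show ?thesis
    unfolding Let_def r_def[symmetric] by (auto simp: max_def)
qed

lemma card_filter_lessThan_4:
  "card {i::nat. i < 4 \<and> P i} =
    of_bool (P 0) + of_bool (P 1) + of_bool (P 2) + of_bool (P 3)"
proof -
  have "{i::nat. i < 4 \<and> P i} = {i \<in> {..<4}. P i}" by auto
  then have "card {i::nat. i < 4 \<and> P i} = (\<Sum>i<4. of_bool (P i))"
    by (simp only: card_eq_sum sum.inter_filter finite_lessThan) (simp add: of_bool_def)
  then show ?thesis by (simp add: lessThan_4)
qed

theorem corollary25:
  fixes n :: nat and p :: "nat \<Rightarrow> int" and h :: int
    and \<delta> :: diagonal and P :: "pretzel_dart diagram" and inc :: "pretzel_dart \<Rightarrow> bool"
  assumes "prime n"
    and "\<forall>i\<in>{1..4}. p i > 0"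
    and "P = pretzel_diagram \<delta> [p 1, p 2, p 3, - p 4]"
    and "orientation P inc"
    and "h = p 1 * p 2 * p 3 - p 1 * p 2 * p 4 - p 1 * p 3 * p 4 - p 2 * p 3 * p 4"
  shows "(\<not> [h = 0] (mod int n) \<longrightarrow>
            card (quandle_hom (fundamental_quandle P inc) (dihedral_quandle n)) = n)
       \<and> ([h = 0] (mod int n) \<and>
          (\<exists>i\<in>{1..4}. \<exists>j\<in>{1..4}. i \<noteq> j \<and> \<not> [p i * p j = 0] (mod int n)) \<longrightarrow>
            card (quandle_hom (fundamental_quandle P inc) (dihedral_quandle n)) = n ^ 2)
       \<and> ((\<exists>!i. i \<in> {1..4} \<and> coprime (p i) (int n)) \<longrightarrow>
            card (quandle_hom (fundamental_quandle P inc) (dihedral_quandle n)) = n ^ 3)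
       \<and> ((\<forall>i\<in>{1..4}. [p i = 0] (mod int n)) \<longrightarrow>
            card (quandle_hom (fundamental_quandle P inc) (dihedral_quandle n)) = n ^ 4)"
proof -
  let ?ps = "[p 1, p 2, p 3, - p 4]"
  let ?card = "card (quandle_hom (fundamental_quandle P inc) (dihedral_quandle n))"
  let ?z = "\<lambda>i. int n dvd p i"
  have prime: "prime (int n)" using assms(1) by simp
  have set4: "{1..4} = {1, 2, 3, 4::nat}" by auto
  define r :: nat
    where "r = of_bool (?z 1) + of_bool (?z 2) + of_bool (?z 3) + of_bool (?z 4)"
  have r: "card {i. i < 4 \<and> int n dvd ?ps ! i} = r"
    by (simp add: card_filter_lessThan_4 numeral_3_eq_3 r_def)
  have "p 1 > 0 \<and> p 2 > 0 \<and> p 3 > 0 \<and> p 4 > 0" using assms(2) by (simp only: set4 ball_simps)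
  then have "0 \<notin> set ?ps" by auto
  then have "?card = card (top_colorings ?ps n)"
    unfolding assms(3) using card_hom_pretzel[of ?ps n] prime_gt_0_nat[OF assms(1)] by simp
  also have "\<dots> = (if r = 0 \<and> int n dvd h then n ^ 2 else n ^ max 1 r)"
  proof -
    have "p 2 * p 3 * - p 4 + p 1 * p 3 * - p 4 + p 1 * p 2 * - p 4 + p 1 * p 2 * p 3 = h"
      by (simp add: assms(5))
    then show ?thesis by (simp only: card_top_colorings_4[OF assms(1)] Let_def r)
  qed
  finally have card: "?card = (if r = 0 \<and> int n dvd h then n ^ 2 else n ^ max 1 r)" .
  \<comment> \<open>Each of the four products in \<open>h\<close> omits a single entry: two entries vanishing modulo \<open>n\<close> kill all of them,
    a single one kills all but one.\<close>
  have two: "int n dvd h" if "r \<ge> 2"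
    using that unfolding r_def assms(5)
    by (auto simp: of_bool_def split: if_splits intro!: dvd_diff)
  have unit: "\<not> int n dvd h" if "int n dvd x" "h = y + x * w" "\<not> int n dvd y" for x y w
    using that by (metis dvd_add_left_iff dvd_mult2)
  have one: "\<not> int n dvd h" if "r = 1"
  proof -
    have not_dvd: "\<not> int n dvd s * (p i * p j * p k)"
      if "\<not> ?z i" "\<not> ?z j" "\<not> ?z k" "s = 1 \<or> s = -1" for s i j k
      using that by (auto simp: prime_dvd_mult_iff[OF prime])
    have "h = -1 * (p 2 * p 3 * p 4) + p 1 * (p 2 * p 3 - p 2 * p 4 - p 3 * p 4)"
      "h = -1 * (p 1 * p 3 * p 4) + p 2 * (p 1 * p 3 - p 1 * p 4 - p 3 * p 4)"
      "h = -1 * (p 1 * p 2 * p 4) + p 3 * (p 1 * p 2 - p 1 * p 4 - p 2 * p 4)"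
      "h = 1 * (p 1 * p 2 * p 3) + p 4 * (- p 1 * p 2 - p 1 * p 3 - p 2 * p 3)"
      unfolding assms(5) by algebra+
    note expand = this
    have "?z 1 \<and> \<not> ?z 2 \<and> \<not> ?z 3 \<and> \<not> ?z 4 \<or> ?z 2 \<and> \<not> ?z 1 \<and> \<not> ?z 3 \<and> \<not> ?z 4 \<or>
        ?z 3 \<and> \<not> ?z 1 \<and> \<not> ?z 2 \<and> \<not> ?z 4 \<or> ?z 4 \<and> \<not> ?z 1 \<and> \<not> ?z 2 \<and> \<not> ?z 3"
      using that unfolding r_def
      by (cases "?z 1"; cases "?z 2"; cases "?z 3"; cases "?z 4") simp_all
    then consider
      "?z 1" "\<not> ?z 2" "\<not> ?z 3" "\<not> ?z 4" | "?z 2" "\<not> ?z 1" "\<not> ?z 3" "\<not> ?z 4"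
      | "?z 3" "\<not> ?z 1" "\<not> ?z 2" "\<not> ?z 4" | "?z 4" "\<not> ?z 1" "\<not> ?z 2" "\<not> ?z 3"
      by argo
    then show ?thesis
    proof cases
      case 1
      show ?thesis by (rule unit[OF 1(1) expand(1) not_dvd[OF 1(2-4)]]) simp
    next
      case 2
      show ?thesis by (rule unit[OF 2(1) expand(2) not_dvd[OF 2(2-4)]]) simp
    next
      case 3
      show ?thesis by (rule unit[OF 3(1) expand(3) not_dvd[OF 3(2-4)]]) simp
    next
      case 4
      show ?thesis by (rule unit[OF 4(1) expand(4) not_dvd[OF 4(2-4)]]) simp
    qed
  qed
  have "?card = n" if "\<not> [h = 0] (mod int n)"
  proof -
    have "\<not> int n dvd h" using that by (simp add: cong_0_iff)
    with two have "r < 2" by (meson not_le)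
    with \<open>\<not> int n dvd h\<close> have "max 1 r = 1" "\<not> (r = 0 \<and> int n dvd h)" by auto
    then show ?thesis unfolding card by (simp only: if_False power_one_right)
  qed
  moreover have "?card = n ^ 2"
    if h: "[h = 0] (mod int n)"
      and pair: "\<exists>i\<in>{1..4}. \<exists>j\<in>{1..4}. i \<noteq> j \<and> \<not> [p i * p j = 0] (mod int n)"
  proof -
    have "int n dvd h" using h by (simp add: cong_0_iff)
    moreover have "r \<le> 2"
    proof -
      obtain i j where "i \<in> {1, 2, 3, 4}" "j \<in> {1, 2, 3, 4}" "i \<noteq> j" "\<not> ?z i" "\<not> ?z j"
        using pair unfolding set4 cong_0_iff by (meson dvd_mult dvd_mult2)
      then show ?thesis unfolding r_def by (auto simp: of_bool_def)
    qed
    ultimately have "r = 0 \<or> r = 2" using one by fastforce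
    with \<open>int n dvd h\<close> show ?thesis by (auto simp: card)
  qed
  moreover have "?card = n ^ 3" if "\<exists>!i. i \<in> {1..4} \<and> coprime (p i) (int n)"
  proof -
    have "coprime (p i) (int n) \<longleftrightarrow> \<not> ?z i" for i
      using prime_imp_coprime[OF prime, of "p i"] not_coprimeI[of "int n" "p i" "int n"] prime
      by (auto simp: coprime_commute)
    with that have "\<exists>!i. i \<in> {1, 2, 3, 4} \<and> \<not> ?z i" by (simp only: set4)
    then obtain i where "i \<in> {1, 2, 3, 4}" "\<not> ?z i" "\<forall>j\<in>{1, 2, 3, 4}. j \<noteq> i \<longrightarrow> ?z j" by metis
    then have "r = 3" unfolding r_def by (auto simp: of_bool_def)
    then show ?thesis by (simp add: card)
  qed
  moreover have "?card = n ^ 4" if "\<forall>i\<in>{1..4}. [p i = 0] (mod int n)"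
  proof -
    have "r = 4" using that unfolding r_def set4 cong_0_iff by simp
    then show ?thesis by (simp add: card)
  qed
  ultimately show ?thesis by blast
qed

end
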